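(* Let $(B(x))_{x\in[0,1]}$ be a Brownian bridge on $[0,1]$. Almost surely the following holds: for every non-constant function $F$ holomorphic on a connected neighbourhood of $B([0,1])$ and real on $B([0,1])$, the set of points $x\in[0,1]$ at which $F\circ B$ has a finite one-sided derivative is either empty, consists of a single point, or has Hausdorff dimension at most $\frac12$.
   Context: A Brownian bridge on $[0,1]$ is a standard Wiener process $W$ conditioned on $W_1=0$, e.g. $B(x)=W_x-xW_1$. *)

theory Defs
  imports "HOL-Probability.Probability" "HOL-Complex_Analysis.Complex_Analysis"
begin

definition bb_cov :: "real \<Rightarrow> real \<Rightarrow> real" where
  "bb_cov s t = min s t - s * t"

definition centered_gaussian :: "'a measure \<Rightarrow> ('a \<Rightarrow> real) \<Rightarrow> real \<Rightarrow> bool" where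
  "centered_gaussian M X v \<longleftrightarrow>
     (if v = 0 then (AE \<omega> in M. X \<omega> = 0)
      else distributed M lborel X (normal_density 0 (sqrt v)))"

text \<open>A Brownian bridge on [0,1]: a centred Gaussian process indexed by [0,1]
  (every finite linear combination of its values is centred Gaussian with the
  variance prescribed by the covariance min s t - s t) with almost surely
  continuous sample paths on [0,1].  Equivalently, it has the law of
  W x - x W 1 for a standard Wiener process W.\<close>
definition brownian_bridge :: "'a measure \<Rightarrow> ('a \<Rightarrow> real \<Rightarrow> real) \<Rightarrow> bool" where
  "brownian_bridge M B \<longleftrightarrow>
     prob_space M \<and>
     (\<forall>t\<in>{0..1}. (\<lambda>\<omega>. B \<omega> t) \<in> borel_measurable M) \<and>
     (\<forall>(n::nat) (ts::nat \<Rightarrow> real) (cs::nat \<Rightarrow> real).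
        (\<forall>i<n. ts i \<in> {0..1}) \<longrightarrow>
        centered_gaussian M (\<lambda>\<omega>. \<Sum>i<n. cs i * B \<omega> (ts i))
          (\<Sum>i<n. \<Sum>j<n. cs i * cs j * bb_cov (ts i) (ts j))) \<and>
     (AE \<omega> in M. continuous_on {0..1} (B \<omega>))"

text \<open>s-dimensional contribution of a covering set (empty sets contribute 0,
  with the convention diam^0 = 1 for nonempty sets).\<close>
definition hcontrib :: "real \<Rightarrow> real set \<Rightarrow> real" where
  "hcontrib s U = (if U = {} then 0 else if s = 0 then 1 else diameter U powr s)"

definition hausdorff_pre :: "real \<Rightarrow> real \<Rightarrow> real set \<Rightarrow> ennreal" where
  "hausdorff_pre s \<delta> A =
     (INF U \<in> {U :: nat \<Rightarrow> real set. A \<subseteq> (\<Union>i. U i) \<and>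
                 (\<forall>i. bounded (U i) \<and> diameter (U i) \<le> \<delta>)}.
        (\<Sum>i. ennreal (hcontrib s (U i))))"

definition hausdorff_measure :: "real \<Rightarrow> real set \<Rightarrow> ennreal" where
  "hausdorff_measure s A = (SUP \<delta> \<in> {0<..}. hausdorff_pre s \<delta> A)"

definition hausdorff_dim :: "real set \<Rightarrow> real" where
  "hausdorff_dim A = Inf {s. 0 \<le> s \<and> hausdorff_measure s A = 0}"

definition has_finite_one_sided_deriv :: "(real \<Rightarrow> real) \<Rightarrow> real \<Rightarrow> bool" where
  "has_finite_one_sided_deriv g x \<longleftrightarrow>
     (x < 1 \<and> (\<exists>D. (g has_real_derivative D) (at x within {x<..1}))) \<or>
     (0 < x \<and> (\<exists>D. (g has_real_derivative D) (at x within {0..<x})))"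

end

theory Submission
  imports Defs "HOL-Real_Asymp.Real_Asymp"
begin

text \<open>
  At a point where \<open>F'(B(x)) \<noteq> 0\<close> a one-sided derivative of \<open>F \<circ> B\<close> makes \<open>B\<close> one-sidedly Lipschitz at
  \<open>x\<close>. Then three consecutive increments of \<open>B\<close> on the grid of mesh \<open>4\<^sup>-\<^sup>r\<close> are \<open>O(4\<^sup>-\<^sup>r)\<close> for all large \<open>r\<close>,
  which has probability \<open>O(4\<^sup>r (2\<^sup>-\<^sup>r)\<^sup>3)\<close> and so almost surely happens nowhere. As \<open>F'\<close> has only finitely
  many zeros on the compact set \<open>B([0,1])\<close>, the exceptional points lie in finitely many level sets of \<open>B\<close>.

  The levels depend on \<open>F\<close>, so the level sets must be bounded simultaneously. The number of grid points
  at which \<open>B\<close> is within \<open>1/(N \<theta>)\<close> of \<open>c\<close> is at most a sum of Fejer kernels, and expanding the kernel bounds it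
  by an average over frequencies \<open>m\<close> of the moduli of the exponential sums of \<open>exp (i m B(k/4\<^sup>r))\<close>, in which
  \<open>c\<close> no longer occurs. The second moment of such a sum is \<open>O(16\<^sup>r/m\<^sup>2)\<close>, so the expected bound is
  \<open>O((r+2)\<^sup>2 2\<^sup>r)\<close>; together with the modulus of continuity \<open>O(r 2\<^sup>-\<^sup>r)\<close> at scale \<open>4\<^sup>-\<^sup>r\<close> this makes all
  Hausdorff measures of dimension larger than 1/2 vanish on every level set.

  Both estimates use only that the cosine of a centred Gaussian with variance \<open>v\<close> has mean \<open>exp (-v/2)\<close>,
  so no independence of increments is needed.
\<close>

section \<open>The Fejer kernel as a majorant of a short window\<close>

definition fejer :: "nat \<Rightarrow> real \<Rightarrow> real \<Rightarrow> real" where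
  "fejer N \<theta> y = 4 / (real N)\<^sup>2 * (\<Sum>j<N. \<Sum>l<N. cos ((real j - real l) * \<theta> * y))"

lemma sum_cos_diff:
  fixes u :: "'i \<Rightarrow> real"
  shows "(\<Sum>j\<in>A. \<Sum>l\<in>A. cos (u j - u l)) = (\<Sum>j\<in>A. cos (u j))\<^sup>2 + (\<Sum>j\<in>A. sin (u j))\<^sup>2"
  by (simp add: cos_diff sum.distrib power2_eq_square sum_product)

text \<open>Grouping the cosines of differences into the squared modulus of one exponential sum
  makes positivity visible. Positivity is what later lets single kernels be bounded by sums of
  kernels.\<close>

lemma fejer_eq:
  "fejer N \<theta> y = 4 / (real N)\<^sup>2 *
     ((\<Sum>j<N. cos (real j * \<theta> * y))\<^sup>2 + (\<Sum>j<N. sin (real j * \<theta> * y))\<^sup>2)"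
  unfolding fejer_def sum_cos_diff[symmetric] by (simp add: algebra_simps)

lemma fejer_nonneg: "0 \<le> fejer N \<theta> y"
  by (simp add: fejer_eq)

lemma cos_ge_half: "\<bar>x\<bar> \<le> 1 \<Longrightarrow> 1 / 2 \<le> cos (x::real)"
proof -
  assume x: "\<bar>x\<bar> \<le> 1"
  have "(sin (x/2))\<^sup>2 \<le> (x/2)\<^sup>2"
    using abs_sin_x_le_abs_x[of "x/2"] by (simp only: abs_le_square_iff)
  also have "\<dots> \<le> 1/4"
    using x abs_square_le_1[of x] by (simp add: power_divide)
  finally show ?thesis
    using cos_double_sin[of "x/2"] by simp
qed

text \<open>Inside the window all \<open>N\<close> angles have modulus at most 1, so every cosine is
  at least 1/2 and the squared cosine sum at least a quarter of the square of \<open>N\<close>. The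
  factor 4 in \<open>fejer\<close> normalises this to 1.\<close>

lemma fejer_ge_1:
  assumes "N > 0" "\<bar>\<theta> * y\<bar> \<le> 1 / real N"
  shows "1 \<le> fejer N \<theta> y"
proof -
  have "1/2 \<le> cos (real j * \<theta> * y)" if "j < N" for j
  proof (rule cos_ge_half)
    have "\<bar>real j * \<theta> * y\<bar> = real j * \<bar>\<theta> * y\<bar>" by (simp add: abs_mult)
    also have "\<dots> \<le> real N * (1 / real N)" using that assms by (intro mult_mono) auto
    finally show "\<bar>real j * \<theta> * y\<bar> \<le> 1" using assms by simp
  qed
  then have "(\<Sum>j<N. 1/2) \<le> (\<Sum>j<N. cos (real j * \<theta> * y))" by (intro sum_mono) auto
  then have "(real N / 2)\<^sup>2 \<le> (\<Sum>j<N. cos (real j * \<theta> * y))\<^sup>2"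
    by (intro power_mono) auto
  then have "(real N / 2)\<^sup>2 \<le> (\<Sum>j<N. cos (real j * \<theta> * y))\<^sup>2 + (\<Sum>j<N. sin (real j * \<theta> * y))\<^sup>2"
    by (simp add: add_increasing2)
  then have "4 / (real N)\<^sup>2 * (real N / 2)\<^sup>2 \<le> fejer N \<theta> y"
    unfolding fejer_eq by (intro mult_left_mono) auto
  then show ?thesis using assms by (simp add: power_divide)
qed

section \<open>Trigonometric and exponential moments of centred Gaussians\<close>

lemma (in prob_space) expectation_cos_gaussian:
  assumes X: "centered_gaussian M X v" and v: "0 \<le> v" and [measurable]: "X \<in> borel_measurable M"
  shows "expectation (\<lambda>\<omega>. cos (X \<omega>)) = exp (- v / 2)"
proof (cases "v = 0")
  case True
  with X have "AE \<omega> in M. cos (X \<omega>) = 1" by (auto simp: centered_gaussian_def)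
  then have "expectation (\<lambda>\<omega>. cos (X \<omega>)) = expectation (\<lambda>\<omega>. 1)"
    using X True by (intro integral_cong_AE) (auto simp: centered_gaussian_def)
  then show ?thesis using True by (simp add: prob_space)
next
  case False
  \<comment> \<open>Dividing by the standard deviation reduces to the standard normal law; the
    cosine integral is then the real part of its characteristic function at
    \<open>\<sigma>\<close>.\<close>
  define \<sigma> where "\<sigma> = sqrt v"
  have \<sigma>: "\<sigma> > 0" "\<sigma>\<^sup>2 = v" using False v by (auto simp: \<sigma>_def)
  have D: "distributed M lborel (\<lambda>\<omega>. X \<omega> / \<sigma>) std_normal_density"
    using X False normal_standard_normal_convert[OF \<sigma>(1), of X 0]
    by (simp add: centered_gaussian_def \<sigma>_def)
  have "expectation (\<lambda>\<omega>. cos (\<sigma> * (X \<omega> / \<sigma>))) = (\<integral>x. std_normal_density x * cos (\<sigma> * x) \<partial>lborel)"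
    by (rule distributed_integral[OF D, symmetric]) auto
  also have "\<dots> = (\<integral>x. cos (\<sigma> * x) \<partial>std_normal_distribution)"
    by (subst integral_density) (auto simp: normal_density_nonneg)
  also have "\<dots> = Re (char std_normal_distribution \<sigma>)"
  proof -
    interpret S: real_distribution std_normal_distribution by (rule real_dist_normal_dist)
    have "integrable std_normal_distribution (\<lambda>x. iexp (\<sigma> * x))"
      by (rule S.integrable_iexp) auto
    then have "(\<integral>x. Re (iexp (\<sigma> * x)) \<partial>std_normal_distribution) = Re (char std_normal_distribution \<sigma>)"
      unfolding char_def by (rule integral_Re)
    then show ?thesis by (simp add: Re_exp)
  qed
  also have "\<dots> = exp (- v / 2)" by (simp add: char_std_normal_distribution \<sigma>)
  finally show ?thesis using \<sigma> by simp
qed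

text \<open>Completing the square turns the weight \<open>exp (a * x)\<close> into a shift of the
  mean from 0 to \<open>a\<close>.\<close>

lemma has_integral_exp_std_normal: "has_bochner_integral lborel (\<lambda>x. std_normal_density x * exp (a * x)) (exp (a\<^sup>2 / 2))"
proof -
  have eq: "std_normal_density x * exp (a * x) = exp (a\<^sup>2 / 2) * normal_density a 1 x" for x
    by (simp add: std_normal_density_def normal_density_def exp_add[symmetric] power2_diff)
       (simp add: field_simps power2_eq_square flip: exp_add)
  have "has_bochner_integral lborel (normal_density a 1) 1"
    using integral_normal_density[of 1 a] integrable_normal_density[of 1 a]
    by (simp add: has_bochner_integral_iff)
  from has_bochner_integral_mult_right[OF this, of "exp (a\<^sup>2/2)"]
  show ?thesis by (simp add: eq)
qed

lemma (in prob_space) has_integral_exp_gaussian: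
  assumes X: "centered_gaussian M X v" and v: "0 \<le> v" and [measurable]: "X \<in> borel_measurable M"
  shows "has_bochner_integral M (\<lambda>\<omega>. exp (X \<omega>)) (exp (v / 2))"
proof (cases "v = 0")
  case True
  with X have "AE \<omega> in M. exp (X \<omega>) = 1" by (auto simp: centered_gaussian_def)
  then have "has_bochner_integral M (\<lambda>\<omega>. exp (X \<omega>)) 1 \<longleftrightarrow> has_bochner_integral M (\<lambda>\<omega>. 1) (1::real)"
    by (intro has_bochner_integral_cong_AE) auto
  moreover have "has_bochner_integral M (\<lambda>\<omega>. 1) (1::real)"
    by (simp add: has_bochner_integral_iff prob_space)
  ultimately show ?thesis using True by simp
next
  case False
  define \<sigma> where "\<sigma> = sqrt v"
  have \<sigma>: "\<sigma> > 0" "\<sigma>\<^sup>2 = v" using False v by (auto simp: \<sigma>_def)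
  have D: "distributed M lborel (\<lambda>\<omega>. X \<omega> / \<sigma>) std_normal_density"
    using X False normal_standard_normal_convert[OF \<sigma>(1), of X 0]
    by (simp add: centered_gaussian_def \<sigma>_def)
  have "expectation (\<lambda>\<omega>. exp (\<sigma> * (X \<omega> / \<sigma>))) = (\<integral>x. std_normal_density x * exp (\<sigma> * x) \<partial>lborel)"
    by (rule distributed_integral[OF D, symmetric]) auto
  moreover have "integrable M (\<lambda>\<omega>. exp (\<sigma> * (X \<omega> / \<sigma>))) = integrable lborel (\<lambda>x. std_normal_density x * exp (\<sigma> * x))"
    by (rule distributed_integrable[OF D, symmetric]) auto
  ultimately show ?thesis using \<sigma> has_integral_exp_std_normal[of \<sigma>]
    by (simp add: has_bochner_integral_iff)
qed

text \<open>By monotone convergence the series of the \<open>X n\<close> has finite integral, so it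
  converges almost everywhere. This plays the part of the Borel-Cantelli lemma throughout.\<close>

lemma AE_tendsto_zero_if_summable:
  fixes X :: "nat \<Rightarrow> 'a \<Rightarrow> real"
  assumes int: "\<And>n. integrable M (X n)" and nn: "\<And>n \<omega>. 0 \<le> X n \<omega>"
    and sm: "summable (\<lambda>n. integral\<^sup>L M (X n))"
  shows "AE \<omega> in M. (\<lambda>n. X n \<omega>) \<longlonglongrightarrow> 0"
proof -
  have [measurable]: "X n \<in> borel_measurable M" for n using int by auto
  have "(\<integral>\<^sup>+\<omega>. (\<Sum>n. ennreal (X n \<omega>)) \<partial>M) = (\<Sum>n. \<integral>\<^sup>+\<omega>. ennreal (X n \<omega>) \<partial>M)"
    by (rule nn_integral_suminf) auto
  also have "\<dots> = (\<Sum>n. ennreal (integral\<^sup>L M (X n)))"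
    by (intro suminf_cong nn_integral_eq_integral int) (auto simp: nn)
  also have "\<dots> = ennreal (\<Sum>n. integral\<^sup>L M (X n))"
    by (intro suminf_ennreal2 sm integral_nonneg_AE) (auto simp: nn)
  finally have "(\<integral>\<^sup>+\<omega>. (\<Sum>n. ennreal (X n \<omega>)) \<partial>M) \<noteq> \<infinity>" by simp
  then have "AE \<omega> in M. (\<Sum>n. ennreal (X n \<omega>)) \<noteq> \<infinity>"
    by (intro nn_integral_PInf_AE) auto
  then show ?thesis
  proof eventually_elim
    case (elim \<omega>)
    then have "summable (\<lambda>n. X n \<omega>)" by (intro summable_suminf_not_top) (auto simp: nn)
    then show ?case by (rule summable_LIMSEQ_zero)
  qed
qed

section \<open>Sums over index distances\<close>

lemma one_div_one_minus_exp:
  assumes "0 < (x::real)" shows "1 / (1 - exp (- x)) \<le> 1 + 1 / x"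
proof -
  have "1 + x \<le> exp x" by (rule exp_ge_add_one_self)
  then have "exp (- x) \<le> 1 / (1 + x)" using assms by (simp add: exp_minus field_simps)
  then have "x / (1 + x) \<le> 1 - exp (- x)" using assms by (simp add: field_simps)
  then have "1 / (1 - exp (- x)) \<le> 1 / (x / (1 + x))"
    using assms by (intro divide_left_mono mult_pos_pos) auto
  then show ?thesis using assms by (simp add: field_simps)
qed

text \<open>Each distance occurs at most twice, once on either side of \<open>k\<close>. The centre
  is an integer because the wrap-around terms of the bridge move it outside the index range.\<close>

lemma sum_dist_le:
  fixes g :: "nat \<Rightarrow> real" and k :: int
  assumes A: "finite A" and D: "finite D" and AD: "\<And>l. l \<in> A \<Longrightarrow> nat \<bar>k - int l\<bar> \<in> D"
    and g: "\<And>d. 0 \<le> g d"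
  shows "(\<Sum>l\<in>A. g (nat \<bar>k - int l\<bar>)) \<le> 2 * (\<Sum>d\<in>D. g d)"
proof -
  define A1 where "A1 = {l\<in>A. int l \<le> k}"
  define A2 where "A2 = {l\<in>A. k < int l}"
  have half: "(\<Sum>l\<in>A'. g (nat \<bar>k - int l\<bar>)) \<le> (\<Sum>d\<in>D. g d)"
    if "A' \<subseteq> A" "inj_on (\<lambda>l. nat \<bar>k - int l\<bar>) A'" for A'
  proof -
    have "(\<Sum>l\<in>A'. g (nat \<bar>k - int l\<bar>)) = sum g ((\<lambda>l. nat \<bar>k - int l\<bar>) ` A')"
      using that by (simp add: sum.reindex)
    also have "\<dots> \<le> sum g D"
      using that AD by (intro sum_mono2 D) (auto simp: g)
    finally show ?thesis .
  qed
  have "A = A1 \<union> A2" "A1 \<inter> A2 = {}" by (auto simp: A1_def A2_def)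
  moreover have "finite A1" "finite A2" using A by (auto simp: A1_def A2_def)
  ultimately have "(\<Sum>l\<in>A. g (nat \<bar>k - int l\<bar>)) =
      (\<Sum>l\<in>A1. g (nat \<bar>k - int l\<bar>)) + (\<Sum>l\<in>A2. g (nat \<bar>k - int l\<bar>))"
    by (simp add: sum.union_disjoint)
  also have "\<dots> \<le> (\<Sum>d\<in>D. g d) + (\<Sum>d\<in>D. g d)"
    by (intro add_mono half) (auto simp: A1_def A2_def inj_on_def)
  finally show ?thesis by simp
qed

text \<open>Either side of \<open>k\<close> is dominated by a full geometric series of ratio
  \<open>exp (- x)\<close>, so the bound depends neither on \<open>A\<close> nor on
  \<open>k\<close>.\<close>

lemma sum_exp_dist_le:
  fixes k :: int
  assumes A: "finite A" and x: "0 < x"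
  shows "(\<Sum>l\<in>A. exp (- x * real (nat \<bar>k - int l\<bar>))) \<le> 2 * (1 + 1 / x)"
proof -
  define q where "q = exp (- x)"
  have q: "0 < q" "q < 1" using x by (auto simp: q_def)
  have e: "exp (- x * real n) = q ^ n" for n
    by (simp add: q_def exp_of_nat_mult[symmetric] mult.commute)
  have "(\<Sum>l\<in>A. exp (- x * real (nat \<bar>k - int l\<bar>))) \<le>
      2 * (\<Sum>d\<in>(\<lambda>l. nat \<bar>k - int l\<bar>) ` A. q ^ d)"
    unfolding e using A q by (intro sum_dist_le) auto
  also have "(\<Sum>d\<in>(\<lambda>l. nat \<bar>k - int l\<bar>) ` A. q ^ d) \<le> 1 / (1 - q)"
    using q A suminf_geometric[of q] sum_le_suminf[of "\<lambda>i. q ^ i" "(\<lambda>l. nat \<bar>k - int l\<bar>) ` A"]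
    by (auto simp: summable_geometric)
  also have "1 / (1 - q) \<le> 1 + 1 / x" unfolding q_def by (rule one_div_one_minus_exp[OF x])
  finally show ?thesis by simp
qed

text \<open>Dyadic blocks: the block from \<open>2 ^ r\<close> to \<open>2 ^ Suc r\<close> has
  \<open>2 ^ r\<close> terms, none above \<open>1 / 2 ^ r\<close>, and so adds at most 1.\<close>

lemma sum_inverse_le: "(\<Sum>d = 1..<2 ^ r. 1 / real d) \<le> real r"
proof (induction r)
  case (Suc r)
  have "(\<Sum>d = 1..<2 ^ Suc r. 1 / real d) = (\<Sum>d = 1..<2 ^ r. 1 / real d) + (\<Sum>d = 2 ^ r..<2 ^ Suc r. 1 / real d)"
    by (rule sum.atLeastLessThan_concat[symmetric]) auto
  also have "(\<Sum>d = 2 ^ r..<2 ^ Suc r. 1 / real d) \<le> (\<Sum>d::nat = 2 ^ r..<2 ^ Suc r. 1 / 2 ^ r)"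
  proof (intro sum_mono)
    fix d :: nat assume "d \<in> {2 ^ r..<2 ^ Suc r}"
    then have "real (2 ^ r) \<le> real d" by (subst of_nat_le_iff) auto
    then show "1 / real d \<le> 1 / 2 ^ r" by (intro divide_left_mono mult_pos_pos less_le_trans[of 0 "2 ^ r" "real d"]) auto
  qed
  also have "\<dots> = 1" by (simp add: of_nat_diff)
  finally show ?case using Suc by simp
qed simp

section \<open>Gaussian laws of the increments of the bridge\<close>

locale bridge = prob_space M for M :: "'a measure" +
  fixes B :: "'a \<Rightarrow> real \<Rightarrow> real"
  assumes brownian_bridge: "brownian_bridge M B"
begin

lemma measurable_B [measurable]: "t \<in> {0..1} \<Longrightarrow> (\<lambda>\<omega>. B \<omega> t) \<in> borel_measurable M"
  using brownian_bridge by (simp add: brownian_bridge_def)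

lemma gaussian_comb:
  fixes n :: nat
  assumes "\<And>i. i < n \<Longrightarrow> ts i \<in> {0..1}"
  shows "centered_gaussian M (\<lambda>\<omega>. \<Sum>i<n. cs i * B \<omega> (ts i))
          (\<Sum>i<n. \<Sum>j<n. cs i * cs j * bb_cov (ts i) (ts j))"
proof -
  have "\<forall>(n::nat) ts cs. (\<forall>i<n. ts i \<in> {0..1}) \<longrightarrow>
      centered_gaussian M (\<lambda>\<omega>. \<Sum>i<n::nat. cs i * B \<omega> (ts i))
        (\<Sum>i<n. \<Sum>j<n. cs i * cs j * bb_cov (ts i) (ts j))"
    using brownian_bridge unfolding brownian_bridge_def by (elim conjE)
  from this[rule_format, of n ts cs] assms show ?thesis by blast
qed

lemma gaussian_diff:
  assumes "s \<in> {0..1}" "t \<in> {0..1}"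
  shows "centered_gaussian M (\<lambda>\<omega>. a * (B \<omega> s - B \<omega> t)) (a\<^sup>2 * (\<bar>s - t\<bar> - \<bar>s - t\<bar>\<^sup>2))"
proof -
  define ts :: "nat \<Rightarrow> real" where "ts i = (if i = 0 then s else t)" for i
  define cs :: "nat \<Rightarrow> real" where "cs i = (if i = 0 then a else - a)" for i
  have "centered_gaussian M (\<lambda>\<omega>. \<Sum>i<2. cs i * B \<omega> (ts i))
          (\<Sum>i<2. \<Sum>j<2. cs i * cs j * bb_cov (ts i) (ts j))"
    by (rule gaussian_comb) (use assms in \<open>auto simp: ts_def\<close>)
  also have "(\<lambda>\<omega>. \<Sum>i<2. cs i * B \<omega> (ts i)) = (\<lambda>\<omega>. a * (B \<omega> s - B \<omega> t))"
    by (simp add: cs_def ts_def numeral_2_eq_2 algebra_simps)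
  also have "(\<Sum>i<2. \<Sum>j<2. cs i * cs j * bb_cov (ts i) (ts j)) = a\<^sup>2 * (\<bar>s - t\<bar> - \<bar>s - t\<bar>\<^sup>2)"
    by (cases "s \<le> t") (simp_all add: cs_def ts_def numeral_2_eq_2 bb_cov_def min_def power2_eq_square algebra_simps)
  finally show ?thesis .
qed

text \<open>The subtracted term is the only trace of the pinning at time 1; without it the
  increments would be independent with variance \<open>h\<close>.\<close>

lemma gaussian_three_increments:
  assumes "0 \<le> t" "0 \<le> h" "t + 3 * h \<le> 1"
  shows "centered_gaussian M
    (\<lambda>\<omega>. a * (B \<omega> (t + h) - B \<omega> t) + b * (B \<omega> (t + 2 * h) - B \<omega> (t + h)) + c * (B \<omega> (t + 3 * h) - B \<omega> (t + 2 * h)))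
    (h * (a\<^sup>2 + b\<^sup>2 + c\<^sup>2) - h\<^sup>2 * (a + b + c)\<^sup>2)"
proof -
  define ts :: "nat \<Rightarrow> real" where "ts i = t + real i * h" for i
  \<comment> \<open>Summation by parts: these are the coefficients of the four values when the three
    increments have coefficients \<open>a\<close>, \<open>b\<close>, \<open>c\<close>.\<close>
  define cs :: "nat \<Rightarrow> real" where "cs i = (if i = 0 then - a else if i = 1 then a - b else if i = 2 then b - c else c)" for i
  have ts: "bb_cov (ts i) (ts j) = ts (min i j) - ts i * ts j" for i j
    using assms by (cases "i \<le> j") (auto simp: bb_cov_def ts_def min_def mult_right_mono antisym)
  have four: "sum f {..<4} = f 0 + f 1 + f 2 + f (3::nat)" for f :: "nat \<Rightarrow> real"
    by (simp add: eval_nat_numeral)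
  have "centered_gaussian M (\<lambda>\<omega>. \<Sum>i<4. cs i * B \<omega> (ts i))
          (\<Sum>i<4. \<Sum>j<4. cs i * cs j * bb_cov (ts i) (ts j))"
  proof (rule gaussian_comb)
    fix i :: nat assume "i < 4"
    then have "real i * h \<le> 3 * h" using assms by (intro mult_right_mono) auto
    then show "ts i \<in> {0..1}" using assms by (auto simp: ts_def)
  qed
  also have "(\<lambda>\<omega>. \<Sum>i<4. cs i * B \<omega> (ts i)) = (\<lambda>\<omega>. a * (B \<omega> (t + h) - B \<omega> t) + b * (B \<omega> (t + 2 * h) - B \<omega> (t + h)) + c * (B \<omega> (t + 3 * h) - B \<omega> (t + 2 * h)))"
    by (simp add: four cs_def ts_def algebra_simps)
  also have "(\<Sum>i<4. \<Sum>j<4. cs i * cs j * bb_cov (ts i) (ts j)) = h * (a\<^sup>2 + b\<^sup>2 + c\<^sup>2) - h\<^sup>2 * (a + b + c)\<^sup>2"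
    unfolding ts four by (simp add: cs_def ts_def power2_eq_square algebra_simps)
  finally show ?thesis .
qed

subsection \<open>Modulus of continuity on the 4-adic grid\<close>

text \<open>Exponential moments and a union bound: after scaling by \<open>2 ^ r\<close> an
  increment has variance below 1, so both exponential moments are at most 2, while the weight
  \<open>exp (- 4 * real r)\<close> beats the \<open>4 ^ r\<close> grid cells. Once
  \<open>G r \<omega>\<close> is below 1, so is each of its terms, which is the asserted
  bound.\<close>

lemma grid_increment_modulus:
  "AE \<omega> in M. \<forall>\<^sub>F r in sequentially. \<forall>k<4 ^ r.
     \<bar>B \<omega> ((real k + 1) / 4 ^ r) - B \<omega> (real k / 4 ^ r)\<bar> \<le> 4 * real r / 2 ^ r"
proof -
  define D where "D r k a \<omega> = a * 2 ^ r * (B \<omega> ((real k + 1) / 4 ^ r) - B \<omega> (real k / 4 ^ r))"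
    for r k :: nat and a :: real and \<omega>
  define G where "G r \<omega> = (\<Sum>k<4 ^ r. (exp (D r k 1 \<omega>) + exp (D r k (- 1) \<omega>)) * exp (- 4 * real r))"
    for r :: nat and \<omega>
  have grid: "(real k + 1) / 4 ^ r \<in> {0..1}" "real k / 4 ^ r \<in> {0..1}" if "k < 4 ^ r" for k r :: nat
  proof -
    have "real (k + 1) \<le> real (4 ^ r)" using that by (subst of_nat_le_iff) simp
    then show "(real k + 1) / 4 ^ r \<in> {0..1}" "real k / 4 ^ r \<in> {0..1}" using that by auto
  qed
  have D: "integrable M (\<lambda>\<omega>. exp (D r k a \<omega>)) \<and> expectation (\<lambda>\<omega>. exp (D r k a \<omega>)) \<le> 2"
    if k: "k < 4 ^ r" and a: "a\<^sup>2 = 1" for r k a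
  proof -
    let ?h = "1 / 4 ^ r :: real"
    have d: "\<bar>(real k + 1) / 4 ^ r - real k / 4 ^ r\<bar> = ?h" by (simp add: diff_divide_distrib[symmetric])
    have v: "(a * 2 ^ r)\<^sup>2 * (?h - ?h\<^sup>2) = 1 - ?h"
    proof -
      have "(2 ^ r)\<^sup>2 = (4::real) ^ r" by (simp add: power2_eq_square flip: power_mult_distrib)
      then have "(a * 2 ^ r)\<^sup>2 = 4 ^ r" using a by (simp add: power_mult_distrib)
      then show ?thesis by (simp add: power2_eq_square right_diff_distrib)
    qed
    have "has_bochner_integral M (\<lambda>\<omega>. exp (D r k a \<omega>)) (exp ((1 - ?h) / 2))"
    proof (rule has_integral_exp_gaussian)
      show "centered_gaussian M (D r k a) (1 - ?h)"
        using gaussian_diff[OF grid[OF k], of "a * 2 ^ r"] unfolding d v D_def .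
      show "D r k a \<in> borel_measurable M"
        unfolding D_def using grid[OF k] by measurable
    qed simp
    moreover have "exp ((1 - ?h) / 2) \<le> 2"
    proof -
      have "exp ((1 - ?h) / 2) \<le> exp (1 / 2)" by simp
      also have "\<dots> \<le> (2::real)" using exp_bound_half[of "1/2::real"] by simp
      finally show ?thesis .
    qed
    ultimately show ?thesis by (auto simp: has_bochner_integral_iff)
  qed
  have "AE \<omega> in M. (\<lambda>r. G r \<omega>) \<longlonglongrightarrow> 0"
  proof (rule AE_tendsto_zero_if_summable)
    show "integrable M (G r)" for r
      unfolding G_def using D by (intro Bochner_Integration.integrable_sum integrable_mult_left Bochner_Integration.integrable_add) auto
    show "0 \<le> G r \<omega>" for r \<omega>
      unfolding G_def by (intro sum_nonneg mult_nonneg_nonneg add_nonneg_nonneg) auto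
    have le: "expectation (G r) \<le> 4 * (1 / 4) ^ r" for r
    proof -
      have "expectation (G r) = (\<Sum>k<4 ^ r. (expectation (\<lambda>\<omega>. exp (D r k 1 \<omega>)) + expectation (\<lambda>\<omega>. exp (D r k (- 1) \<omega>))) * exp (- 4 * real r))"
        unfolding G_def using D by (subst Bochner_Integration.integral_sum) (auto intro!: sum.cong simp: Bochner_Integration.integral_add)
      also have "\<dots> \<le> (\<Sum>k<(4::nat) ^ r. (2 + 2) * exp (- 4 * real r))"
        using D by (intro sum_mono mult_right_mono add_mono) auto
      also have "\<dots> = 4 * (4 * exp (- 4)) ^ r"
        by (simp add: power_mult_distrib exp_of_nat_mult[symmetric] mult.commute)
      also have "\<dots> \<le> 4 * (1 / 4) ^ r"
      proof (intro mult_left_mono power_mono)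
        \<comment> \<open>The crude bound \<open>2 \<le> exp 1\<close> suffices:
          \<open>4 * exp (- 4)\<close> is then at most 4/16.\<close>
        have "(2::real) ^ 4 \<le> exp 1 ^ 4" using exp_ge_add_one_self[of 1] by (intro power_mono) auto
        also have "exp 1 ^ 4 = exp (4::real)" by (simp add: exp_of_nat_mult[symmetric])
        finally show "4 * exp (- 4) \<le> (1 / 4 :: real)" by (simp add: exp_minus field_simps)
      qed auto
      finally show ?thesis .
    qed
    have "summable (\<lambda>r. 4 * (1 / 4) ^ r :: real)" by (intro summable_mult summable_geometric) auto
    then show "summable (\<lambda>r. expectation (G r))"
    proof (rule summable_comparison_test')
      fix r :: nat assume "0 \<le> r"
      have "0 \<le> expectation (G r)"
        unfolding G_def by (intro integral_nonneg_AE AE_I2 sum_nonneg mult_nonneg_nonneg add_nonneg_nonneg) auto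
      with le show "norm (expectation (G r)) \<le> 4 * (1 / 4) ^ r" by simp
    qed
  qed
  then show ?thesis
  proof eventually_elim
    case (elim \<omega>)
    then have "\<forall>\<^sub>F r in sequentially. G r \<omega> < 1" by (rule order_tendstoD) simp
    then show ?case
    proof eventually_elim
      case (elim r)
      show ?case
      proof (intro allI impI)
        fix k :: nat assume k: "k < 4 ^ r"
        have "(exp (D r k 1 \<omega>) + exp (D r k (- 1) \<omega>)) * exp (- 4 * real r) \<le> G r \<omega>"
          unfolding G_def by (rule member_le_sum) (use k in \<open>auto simp: add_nonneg_nonneg\<close>)
        with elim have "exp (D r k 1 \<omega>) * exp (- 4 * real r) + exp (D r k (- 1) \<omega>) * exp (- 4 * real r) < 1"
          by (simp add: distrib_right)
        moreover have "0 < exp (D r k a \<omega>) * exp (- 4 * real r)" for a by simp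
        ultimately have "exp (D r k 1 \<omega>) * exp (- 4 * real r) < 1" "exp (D r k (- 1) \<omega>) * exp (- 4 * real r) < 1"
          by (smt (verit))+
        then have "D r k 1 \<omega> < 4 * real r" "D r k (- 1) \<omega> < 4 * real r"
          by (simp_all flip: exp_add)
        then have "2 ^ r * \<bar>B \<omega> ((real k + 1) / 4 ^ r) - B \<omega> (real k / 4 ^ r)\<bar> \<le> 4 * real r"
          by (auto simp: D_def abs_if algebra_simps)
        then show "\<bar>B \<omega> ((real k + 1) / 4 ^ r) - B \<omega> (real k / 4 ^ r)\<bar> \<le> 4 * real r / 2 ^ r"
          by (simp add: field_simps)
      qed
    qed
  qed
qed

end

subsection \<open>Level counts on the 4-adic grid\<close>

text \<open>\<open>osc_sum r m f\<close> is the modulus of the sum of \<open>exp (i m f(k / 4\<^sup>r))\<close> over \<open>k \<le> 4\<^sup>r\<close>;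
  taking moduli makes \<open>level_sum\<close> independent of the level, so one random variable bounds
  the counts of all levels at once.\<close>
definition osc_sum :: "nat \<Rightarrow> real \<Rightarrow> (real \<Rightarrow> real) \<Rightarrow> real" where
  "osc_sum r m f = sqrt ((\<Sum>k\<le>4 ^ r. cos (m * f (real k / 4 ^ r)))\<^sup>2 + (\<Sum>k\<le>4 ^ r. sin (m * f (real k / 4 ^ r)))\<^sup>2)"

text \<open>Scaled so that a window of radius \<open>12 * (real r + 2) / 2 ^ r\<close>, the chaining
  bound of \<open>grid_modulus_imp_modulus\<close>, becomes exactly \<open>1 / 2 ^ r\<close>, the
  width resolved by a kernel with \<open>2 ^ r\<close> frequencies.\<close>

definition level_freq :: "nat \<Rightarrow> real" where
  "level_freq r = 1 / (12 * (real r + 2))"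

definition level_sum :: "nat \<Rightarrow> (real \<Rightarrow> real) \<Rightarrow> real" where
  "level_sum r f = 4 / (2 ^ r)\<^sup>2 * (\<Sum>j<2 ^ r. \<Sum>l<2 ^ r. osc_sum r ((real j - real l) * level_freq r) f)"

lemma level_freq_pos: "0 < level_freq r"
  by (simp add: level_freq_def)

lemma level_sum_nonneg: "0 \<le> level_sum r f"
  unfolding level_sum_def osc_sum_def by (intro mult_nonneg_nonneg sum_nonneg) auto

text \<open>Cauchy-Schwarz: by the addition formula the left side is the inner product of the pair
  of cosine and sine sums with the unit vector at angle \<open>m * c\<close>. This is the step that
  removes the level \<open>c\<close>.\<close>

lemma sum_cos_shift_le: "(\<Sum>k\<le>4 ^ r. cos (m * (f (real k / 4 ^ r) - c))) \<le> osc_sum r m f"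
proof -
  define P where "P = (\<Sum>k\<le>(4::nat) ^ r. cos (m * f (real k / 4 ^ r)))"
  define Q where "Q = (\<Sum>k\<le>(4::nat) ^ r. sin (m * f (real k / 4 ^ r)))"
  define a where "a = cos (m * c)"
  define b where "b = sin (m * c)"
  have ab: "a\<^sup>2 + b\<^sup>2 = 1" by (simp add: a_def b_def)
  have "(\<Sum>k\<le>4 ^ r. cos (m * (f (real k / 4 ^ r) - c))) = P * a + Q * b"
    by (simp add: P_def Q_def a_def b_def right_diff_distrib cos_diff sum.distrib sum_distrib_right)
  also have "\<dots> \<le> sqrt (P\<^sup>2 + Q\<^sup>2)"
  proof (rule real_le_rsqrt)
    have "(P * a + Q * b)\<^sup>2 + (P * b - Q * a)\<^sup>2 = (P\<^sup>2 + Q\<^sup>2) * (a\<^sup>2 + b\<^sup>2)"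
      by (simp add: power2_eq_square algebra_simps)
    then have "(P * a + Q * b)\<^sup>2 + (P * b - Q * a)\<^sup>2 = P\<^sup>2 + Q\<^sup>2" using ab by simp
    then show "(P * a + Q * b)\<^sup>2 \<le> P\<^sup>2 + Q\<^sup>2"
      using zero_le_power2[of "P * b - Q * a"] by linarith
  qed
  finally show ?thesis by (simp add: P_def Q_def osc_sum_def)
qed

text \<open>Every counted grid point has kernel value at least 1 and all others are nonnegative.
  Interchanging the sums puts the sum over grid points innermost, where
  \<open>sum_cos_shift_le\<close> applies to each frequency separately.\<close>

lemma card_level_le:
  "real (card {k. k \<le> 4 ^ r \<and> \<bar>f (real k / 4 ^ r) - c\<bar> \<le> 12 * (real r + 2) / 2 ^ r}) \<le> level_sum r f"
proof -
  let ?A = "{k. k \<le> 4 ^ r \<and> \<bar>f (real k / 4 ^ r) - c\<bar> \<le> 12 * (real r + 2) / 2 ^ r}"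
  have "real (card ?A) = (\<Sum>k\<in>?A. 1)" by simp
  also have "\<dots> \<le> (\<Sum>k\<in>?A. fejer (2 ^ r) (level_freq r) (f (real k / 4 ^ r) - c))"
  proof (intro sum_mono fejer_ge_1)
    fix k assume "k \<in> ?A"
    then have "level_freq r * \<bar>f (real k / 4 ^ r) - c\<bar> \<le> level_freq r * (12 * (real r + 2) / 2 ^ r)"
      using level_freq_pos[of r] by (intro mult_left_mono) auto
    also have "\<dots> = 1 / real (2 ^ r)" by (simp add: level_freq_def)
    finally show "\<bar>level_freq r * (f (real k / 4 ^ r) - c)\<bar> \<le> 1 / real (2 ^ r)"
      using level_freq_pos[of r] by (simp add: abs_mult)
  qed auto
  also have "\<dots> \<le> (\<Sum>k\<le>4 ^ r. fejer (2 ^ r) (level_freq r) (f (real k / 4 ^ r) - c))"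
    by (intro sum_mono2) (auto simp: fejer_nonneg)
  also have "\<dots> = 4 / (2 ^ r)\<^sup>2 * (\<Sum>k\<le>4 ^ r. \<Sum>j<2 ^ r. \<Sum>l<2 ^ r. cos ((real j - real l) * level_freq r * (f (real k / 4 ^ r) - c)))"
    by (simp add: fejer_def sum_distrib_left)
  also have "(\<Sum>k\<le>4 ^ r. \<Sum>j<2 ^ r. \<Sum>l<2 ^ r. cos ((real j - real l) * level_freq r * (f (real k / 4 ^ r) - c)))
     = (\<Sum>j<2 ^ r. \<Sum>l<2 ^ r. \<Sum>k\<le>4 ^ r. cos ((real j - real l) * level_freq r * (f (real k / 4 ^ r) - c)))"
    by (subst sum.swap) (simp add: sum.swap[of _ "{..4 ^ r}"])
  also have "4 / (2 ^ r)\<^sup>2 * \<dots> \<le> level_sum r f"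
    unfolding level_sum_def by (intro mult_left_mono sum_mono sum_cos_shift_le) auto
  finally show ?thesis .
qed

lemma summable_poly_geometric:
  fixes q :: real assumes "0 < q" "q < 1"
  shows "summable (\<lambda>r. (real r + 2)\<^sup>2 * q ^ r)"
proof -
  have "(\<lambda>r. ((real r + 3) / (real r + 2))\<^sup>2 * q) \<longlonglongrightarrow> 1 * q"
    by (intro tendsto_mult tendsto_const) real_asymp
  then have "\<forall>\<^sub>F r in sequentially. ((real r + 3) / (real r + 2))\<^sup>2 * q < (1 + q) / 2"
    by (rule order_tendstoD) (use assms in auto)
  then obtain N where N: "\<And>r. N \<le> r \<Longrightarrow> ((real r + 3) / (real r + 2))\<^sup>2 * q < (1 + q) / 2"
    by (auto simp: eventually_sequentially)
  show ?thesis
  proof (rule summable_ratio_test[of "(1 + q) / 2" N])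
    fix r assume "N \<le> r"
    have "(real (Suc r) + 2)\<^sup>2 * q ^ Suc r = ((real r + 3) / (real r + 2))\<^sup>2 * q * ((real r + 2)\<^sup>2 * q ^ r)"
      by (simp add: power_divide add_eq_0_iff)
    also have "\<dots> \<le> (1 + q) / 2 * ((real r + 2)\<^sup>2 * q ^ r)"
      using N[OF \<open>N \<le> r\<close>] assms by (intro mult_right_mono) auto
    finally show "norm ((real (Suc r) + 2)\<^sup>2 * q ^ Suc r) \<le> (1 + q) / 2 * norm ((real r + 2)\<^sup>2 * q ^ r)"
      using assms by simp
  qed (use assms in auto)
qed

lemma grid_in: "k \<le> 4 ^ r \<Longrightarrow> real k / 4 ^ r \<in> {0..1}" for k :: nat
proof -
  assume "k \<le> 4 ^ r"
  then have "real k \<le> real (4 ^ r)" by (subst of_nat_le_iff) 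
  then show ?thesis by simp
qed

lemma osc_sum_le: "osc_sum r m f \<le> 2 * 4 ^ r + 2"
proof -
  define P where "P = (\<Sum>k\<le>(4::nat) ^ r. cos (m * f (real k / 4 ^ r)))"
  define Q where "Q = (\<Sum>k\<le>(4::nat) ^ r. sin (m * f (real k / 4 ^ r)))"
  have "\<bar>P\<bar> \<le> (\<Sum>k\<le>(4::nat) ^ r. 1)" unfolding P_def by (rule order_trans[OF sum_abs sum_mono]) auto
  moreover have "\<bar>Q\<bar> \<le> (\<Sum>k\<le>(4::nat) ^ r. 1)" unfolding Q_def by (rule order_trans[OF sum_abs sum_mono]) auto
  moreover have "sqrt (P\<^sup>2 + Q\<^sup>2) \<le> \<bar>P\<bar> + \<bar>Q\<bar>" by (rule sqrt_sum_squares_le_sum_abs)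
  ultimately show ?thesis by (simp add: osc_sum_def P_def Q_def)
qed

lemma osc_sum_nonneg: "0 \<le> osc_sum r m f"
  by (simp add: osc_sum_def)

context bridge begin

lemma measurable_osc_sum [measurable]: "(\<lambda>\<omega>. osc_sum r m (B \<omega>)) \<in> borel_measurable M"
proof -
  have [measurable]: "(\<lambda>\<omega>. B \<omega> (real k / 4 ^ r)) \<in> borel_measurable M" if "k \<in> {..4 ^ r}" for k
    using grid_in that by (intro measurable_B) auto
  show ?thesis unfolding osc_sum_def by measurable
qed

lemma integrable_osc_sum: "integrable M (\<lambda>\<omega>. osc_sum r m (B \<omega>))"
  by (rule integrable_const_bound[where B = "2 * 4 ^ r + 2"])
     (auto simp: osc_sum_nonneg osc_sum_le)

text \<open>The square expands into a double sum of cosines of bridge increments, whose means are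
  known explicitly. Within each row they decay exponentially in the cyclic index distance, so each
  of the \<open>4 ^ r + 1\<close> rows sums to a multiple of
  \<open>4 ^ r / m\<^sup>2\<close>.\<close>

lemma expectation_osc_sum_sq:
  assumes m: "m \<noteq> 0" "m\<^sup>2 \<le> 4 ^ r"
  shows "expectation (\<lambda>\<omega>. (osc_sum r m (B \<omega>))\<^sup>2) \<le> 64 * (4 ^ r / \<bar>m\<bar>)\<^sup>2"
proof -
  define R :: real where "R = 4 ^ r"
  have R: "R \<ge> 1" by (simp add: R_def)
  \<comment> \<open>Since \<open>d * (1 - d)\<close> is at least half of the smaller factor, the
    exponent is at least \<open>m\<^sup>2 / 4\<close> times that factor; \<open>x\<close> is this
    rate per grid step.\<close>
  define x where "x = m\<^sup>2 / (4 * R)"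
  have x: "x > 0" using m R by (simp add: x_def)
  let ?E = "\<lambda>i l. exp (- x * real (nat \<bar>i - int l\<bar>))"
  let ?b = "\<lambda>k. real k / 4 ^ r"
  \<comment> \<open>The variance of a bridge increment over distance \<open>d\<close> is \<open>d (1 - d)\<close>, which is small also
    near \<open>d = 1\<close>; the two shifted terms account for that wrap-around.\<close>
  have one: "expectation (\<lambda>\<omega>. cos (m * B \<omega> (?b k) - m * B \<omega> (?b l)))
      \<le> ?E (int k) l + ?E (int k + 4 ^ r) l + ?E (int k - 4 ^ r) l"
    if kl: "k \<le> 4 ^ r" "l \<le> 4 ^ r" for k l
  proof -
    define d where "d = \<bar>?b k - ?b l\<bar>"
    have d: "d = real (nat \<bar>int k - int l\<bar>) / R"
      by (simp add: d_def R_def diff_divide_distrib[symmetric])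
    have "\<bar>a - b\<bar> \<le> 1" if "a \<in> {0..1}" "b \<in> {0..1}" for a b :: real using that by auto
    from this[OF grid_in[OF kl(1)] grid_in[OF kl(2)]] have d01: "0 \<le> d" "d \<le> 1" by (auto simp: d_def)
    have "expectation (\<lambda>\<omega>. cos (m * (B \<omega> (?b k) - B \<omega> (?b l)))) = exp (- (m\<^sup>2 * (d - d\<^sup>2)) / 2)"
    proof (rule expectation_cos_gaussian)
      show "centered_gaussian M (\<lambda>\<omega>. m * (B \<omega> (?b k) - B \<omega> (?b l))) (m\<^sup>2 * (d - d\<^sup>2))"
        unfolding d_def by (rule gaussian_diff[OF grid_in[OF kl(1)] grid_in[OF kl(2)]])
      show "0 \<le> m\<^sup>2 * (d - d\<^sup>2)" using d01 by (simp add: power2_eq_square mult_left_le)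
    qed (use grid_in kl in measurable)
    also have "\<dots> \<le> exp (- x * (R * d)) + exp (- x * (R * (1 - d)))"
    proof (cases "d \<le> 1 / 2")
      case True
      have "d * (1/2) \<le> d * (1 - d)" using True d01 by (intro mult_left_mono) auto
      then have "m\<^sup>2 * (d * (1/2)) \<le> m\<^sup>2 * (d - d\<^sup>2)"
        by (intro mult_left_mono) (auto simp: power2_eq_square algebra_simps)
      then have "- (m\<^sup>2 * (d - d\<^sup>2)) / 2 \<le> - x * (R * d)" using R by (simp add: x_def mult.commute)
      then have "exp (- (m\<^sup>2 * (d - d\<^sup>2)) / 2) \<le> exp (- x * (R * d))" by simp
      then show ?thesis by (simp add: add_increasing2)
    next
      case False
      have "(1 - d) * (1/2) \<le> (1 - d) * d" using False d01 by (intro mult_left_mono) auto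
      then have "m\<^sup>2 * ((1 - d) * (1/2)) \<le> m\<^sup>2 * (d - d\<^sup>2)"
        by (intro mult_left_mono) (auto simp: power2_eq_square algebra_simps)
      then have "- (m\<^sup>2 * (d - d\<^sup>2)) / 2 \<le> - x * (R * (1 - d))" using R by (simp add: x_def mult.commute)
      then have "exp (- (m\<^sup>2 * (d - d\<^sup>2)) / 2) \<le> exp (- x * (R * (1 - d)))" by simp
      then show ?thesis by (simp add: add_increasing)
    qed
    also have "exp (- x * (R * d)) = ?E (int k) l" using R by (simp add: d)
    \<comment> \<open>\<open>R * (1 - d)\<close> is the index distance from \<open>l\<close> to
      \<open>k\<close> shifted by one period, upwards if \<open>k \<le> l\<close> and downwards
      otherwise; the remaining term is merely nonnegative.\<close>
    also have "exp (- x * (R * (1 - d))) \<le> ?E (int k + 4 ^ r) l + ?E (int k - 4 ^ r) l"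
    proof -
      have Rd: "R * (1 - d) = 4 ^ r - real (nat \<bar>int k - int l\<bar>)" using R by (simp add: d right_diff_distrib) (simp add: R_def)
      show ?thesis
      proof (cases "k \<le> l")
        case True
        have "int l \<le> 4 ^ r" using kl by simp
        then have nn: "0 \<le> int k + 4 ^ r - int l" by linarith
        then have "real (nat \<bar>int k + 4 ^ r - int l\<bar>) = real_of_int (int k + 4 ^ r - int l)"
          by (simp only: abs_of_nonneg of_nat_nat)
        then have "R * (1 - d) = real (nat \<bar>(int k + 4 ^ r) - int l\<bar>)" unfolding Rd using True by (simp add: abs_if)
        then show ?thesis by (simp add: add_increasing2)
      next
        case False
        have "int k \<le> 4 ^ r" using kl by simp
        then have nn: "int k - 4 ^ r - int l \<le> 0" by linarith
        then have "real (nat \<bar>int k - 4 ^ r - int l\<bar>) = real_of_int (- (int k - 4 ^ r - int l))"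
          by (simp only: abs_of_nonpos of_nat_nat neg_0_le_iff_le)
        then have "R * (1 - d) = real (nat \<bar>(int k - 4 ^ r) - int l\<bar>)" unfolding Rd using False by (simp add: abs_if)
        then show ?thesis by (simp add: add_increasing)
      qed
    qed
    finally show ?thesis by (simp add: right_diff_distrib)
  qed
  have int: "integrable M (\<lambda>\<omega>. cos (m * B \<omega> (?b k) - m * B \<omega> (?b l)))" if "k \<le> 4 ^ r" "l \<le> 4 ^ r" for k l
  proof -
    have "(\<lambda>\<omega>. B \<omega> (?b k)) \<in> borel_measurable M" "(\<lambda>\<omega>. B \<omega> (?b l)) \<in> borel_measurable M"
      using grid_in that by (auto intro!: measurable_B)
    then show ?thesis by (intro integrable_const_bound[where B = 1]) auto
  qed
  have "(osc_sum r m (B \<omega>))\<^sup>2 = (\<Sum>k\<le>4 ^ r. \<Sum>l\<le>4 ^ r. cos (m * B \<omega> (?b k) - m * B \<omega> (?b l)))" for \<omega>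
    by (simp add: osc_sum_def sum_cos_diff)
  then have "expectation (\<lambda>\<omega>. (osc_sum r m (B \<omega>))\<^sup>2) =
      expectation (\<lambda>\<omega>. \<Sum>k\<le>4 ^ r. \<Sum>l\<le>4 ^ r. cos (m * B \<omega> (?b k) - m * B \<omega> (?b l)))"
    by simp
  also have "\<dots> =
      (\<Sum>k\<le>4 ^ r. \<Sum>l\<le>4 ^ r. expectation (\<lambda>\<omega>. cos (m * B \<omega> (?b k) - m * B \<omega> (?b l))))"
    by (subst Bochner_Integration.integral_sum)
       (auto intro!: Bochner_Integration.integrable_sum Bochner_Integration.integral_sum int sum.cong)
  also have "\<dots> \<le> (\<Sum>k\<le>(4::nat) ^ r. \<Sum>l\<le>4 ^ r. ?E (int k) l + ?E (int k + 4 ^ r) l + ?E (int k - 4 ^ r) l)"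
    by (intro sum_mono one) auto
  also have "\<dots> = (\<Sum>k\<le>(4::nat) ^ r. (\<Sum>l\<le>4 ^ r. ?E (int k) l) + (\<Sum>l\<le>4 ^ r. ?E (int k + 4 ^ r) l) + (\<Sum>l\<le>4 ^ r. ?E (int k - 4 ^ r) l))"
    by (simp add: sum.distrib)
  also have "\<dots> \<le> (\<Sum>k\<le>(4::nat) ^ r. 2 * (1 + 1 / x) + 2 * (1 + 1 / x) + 2 * (1 + 1 / x))"
    using x by (intro sum_mono add_mono sum_exp_dist_le) auto
  also have "\<dots> = (R + 1) * (6 * (1 + 1 / x))" by (simp add: R_def algebra_simps)
  also have "\<dots> \<le> (R + 1) * (6 * (5 * R / m\<^sup>2))"
  proof -
    \<comment> \<open>As \<open>1 / x\<close> equals \<open>4 * R / m\<^sup>2\<close>, the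
      restriction on the frequency absorbs the summand 1.\<close>
    have "1 \<le> R / m\<^sup>2" using m by (simp add: R_def)
    then have "1 + 1 / x \<le> 5 * R / m\<^sup>2" by (simp add: x_def)
    then show ?thesis using R by (intro mult_left_mono) auto
  qed
  \<comment> \<open>The factor 64/30, slightly more than the 2 that \<open>R + 1 \<le> 2 * R\<close>
    calls for, cancels the 30 and leaves the perfect square 64.\<close>
  also have "\<dots> \<le> (32 / 30 * R + 32 / 30 * R) * (6 * (5 * R / m\<^sup>2))" using R by (intro mult_right_mono) auto
  also have "\<dots> = 64 * (R / \<bar>m\<bar>)\<^sup>2" by (simp add: power2_eq_square)
  finally show ?thesis by (simp add: R_def)
qed

lemma expectation_osc_sum:
  assumes m: "m \<noteq> 0" "m\<^sup>2 \<le> 4 ^ r"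
  shows "expectation (\<lambda>\<omega>. osc_sum r m (B \<omega>)) \<le> 8 * 4 ^ r / \<bar>m\<bar>"
proof -
  \<comment> \<open>The square root of the second-moment bound, which makes the two halves of the
    AM-GM bound balance.\<close>
  define c where "c = 8 * 4 ^ r / \<bar>m\<bar>"
  have c: "c > 0" using m by (simp add: c_def)
  have sq: "integrable M (\<lambda>\<omega>. (osc_sum r m (B \<omega>))\<^sup>2)"
    by (rule integrable_const_bound[where B = "(2 * 4 ^ r + 2)\<^sup>2"])
       (auto intro!: power_mono simp: osc_sum_nonneg osc_sum_le)
  \<comment> \<open>AM-GM replaces Jensen's inequality: \<open>y \<le> (y\<^sup>2/c + c)/2\<close>.\<close>
  have "expectation (\<lambda>\<omega>. osc_sum r m (B \<omega>)) \<le> expectation (\<lambda>\<omega>. ((osc_sum r m (B \<omega>))\<^sup>2 / c + c) / 2)"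
  proof (intro integral_mono integrable_osc_sum)
    show "integrable M (\<lambda>\<omega>. ((osc_sum r m (B \<omega>))\<^sup>2 / c + c) / 2)" using sq by auto
    fix \<omega>
    have "0 \<le> (osc_sum r m (B \<omega>) - c)\<^sup>2" by simp
    then show "osc_sum r m (B \<omega>) \<le> ((osc_sum r m (B \<omega>))\<^sup>2 / c + c) / 2"
      using c by (simp add: field_simps power2_eq_square)
  qed
  also have "\<dots> = (expectation (\<lambda>\<omega>. (osc_sum r m (B \<omega>))\<^sup>2) / c + c) / 2"
    using sq by (simp add: prob_space)
  also have "\<dots> \<le> (c\<^sup>2 / c + c) / 2"
  proof -
    have "expectation (\<lambda>\<omega>. (osc_sum r m (B \<omega>))\<^sup>2) \<le> c\<^sup>2"
      using expectation_osc_sum_sq[OF m] by (simp add: c_def power_mult_distrib power_divide)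
    then show ?thesis using c by (simp add: divide_right_mono)
  qed
  also have "\<dots> = c" using c by (simp add: power2_eq_square)
  finally show ?thesis by (simp add: c_def)
qed

text \<open>Frequency 0 gets the trivial bound, while index distance \<open>d\<close> gets a
  multiple of \<open>4 ^ r / d\<close> divided by \<open>level_freq r\<close>. One factor of order
  \<open>r\<close> comes from the harmonic sum and another from the inverse of
  \<open>level_freq r\<close>; averaging over the \<open>2 ^ r\<close> rows leaves
  \<open>2 ^ r\<close>.\<close>

lemma expectation_level_sum:
  "expectation (\<lambda>\<omega>. level_sum r (B \<omega>)) \<le> 800 * (real r + 2)\<^sup>2 * 2 ^ r"
proof -
  let ?\<theta> = "level_freq r"
  define g where "g d = (if d = 0 then 4 * 4 ^ r else 8 * 4 ^ r / ?\<theta> * (1 / real d))" for d :: nat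
  have g: "expectation (\<lambda>\<omega>. osc_sum r ((real j - real l) * ?\<theta>) (B \<omega>)) \<le> g (nat \<bar>int j - int l\<bar>)"
    if jl: "j < 2 ^ r" "l < 2 ^ r" for j l
  proof (cases "j = l")
    case True
    have "expectation (\<lambda>\<omega>. osc_sum r ((real j - real l) * ?\<theta>) (B \<omega>)) \<le> expectation (\<lambda>\<omega>. 2 * 4 ^ r + 2)"
      by (intro integral_mono integrable_osc_sum osc_sum_le) auto
    also have "\<dots> \<le> 4 * 4 ^ r" by (simp add: prob_space)
    finally show ?thesis using True by (simp add: g_def)
  next
    case False
    let ?m = "(real j - real l) * ?\<theta>"
    \<comment> \<open>Checks the frequency restriction of
      \<open>expectation_osc_sum\<close>.\<close>
    have "\<bar>real j - real l\<bar> * \<bar>?\<theta>\<bar> \<le> 2 ^ r * 1"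
    proof (intro mult_mono)
      have "real j \<le> 2 ^ r" "real l \<le> 2 ^ r" using jl by auto
      then show "\<bar>real j - real l\<bar> \<le> 2 ^ r" by linarith
      show "\<bar>?\<theta>\<bar> \<le> 1" by (simp add: level_freq_def)
    qed auto
    then have "?m\<^sup>2 \<le> (2 ^ r)\<^sup>2" by (simp add: abs_le_square_iff[symmetric] abs_mult)
    also have "(2 ^ r)\<^sup>2 = (4 ^ r :: real)" by (simp add: power2_eq_square flip: power_mult_distrib)
    finally have "expectation (\<lambda>\<omega>. osc_sum r ?m (B \<omega>)) \<le> 8 * 4 ^ r / \<bar>?m\<bar>"
      using False level_freq_pos[of r] by (intro expectation_osc_sum) auto
    also have "\<dots> = g (nat \<bar>int j - int l\<bar>)"
      using False level_freq_pos[of r] by (simp add: g_def abs_mult mult.commute)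
    finally show ?thesis .
  qed
  have g_sum: "(\<Sum>d<2 ^ r. g d) \<le> 4 ^ r * 100 * (real r + 2)\<^sup>2"
  proof -
    have "{..<2 ^ r} = insert 0 {1..<(2::nat) ^ r}" by auto
    then have "(\<Sum>d<2 ^ r. g d) = g 0 + (\<Sum>d = 1..<2 ^ r. g d)" by simp
    also have "(\<Sum>d = 1..<2 ^ r. g d) = 8 * 4 ^ r / ?\<theta> * (\<Sum>d = 1..<2 ^ r. 1 / real d)"
      unfolding sum_distrib_left by (intro sum.cong) (auto simp: g_def)
    also have "\<dots> \<le> 8 * 4 ^ r / ?\<theta> * real r"
      using level_freq_pos[of r] by (intro mult_left_mono sum_inverse_le) auto
    also have "g 0 + 8 * 4 ^ r / ?\<theta> * real r = 4 ^ r * (4 + 96 * (real r + 2) * real r)"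
      by (simp add: g_def level_freq_def algebra_simps)
    also have "\<dots> \<le> 4 ^ r * (100 * (real r + 2)\<^sup>2)"
      by (intro mult_left_mono) (auto simp: power2_eq_square algebra_simps)
    finally show ?thesis by (simp add: mult.assoc)
  qed
  have "expectation (\<lambda>\<omega>. level_sum r (B \<omega>)) = 4 / (2 ^ r)\<^sup>2 * (\<Sum>j<2 ^ r. \<Sum>l<2 ^ r. expectation (\<lambda>\<omega>. osc_sum r ((real j - real l) * ?\<theta>) (B \<omega>)))"
    unfolding level_sum_def using integrable_osc_sum by (simp add: Bochner_Integration.integral_sum)
  also have "\<dots> \<le> 4 / (2 ^ r)\<^sup>2 * (\<Sum>j<(2::nat) ^ r. \<Sum>l<2 ^ r. g (nat \<bar>int j - int l\<bar>))"
    using g by (intro mult_left_mono sum_mono) auto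
  also have "\<dots> \<le> 4 / (2 ^ r)\<^sup>2 * (\<Sum>j<(2::nat) ^ r. 2 * (\<Sum>d<2 ^ r. g d))"
  proof (intro mult_left_mono sum_mono sum_dist_le)
    fix j l :: nat assume "j \<in> {..<2 ^ r}" "l \<in> {..<2 ^ r}"
    then have "nat \<bar>int j - int l\<bar> \<le> max j l" "max j l < 2 ^ r" by auto
    then have "nat \<bar>int j - int l\<bar> < 2 ^ r" by (rule le_less_trans)
    then show "nat \<bar>int j - int l\<bar> \<in> {..<2 ^ r}" by (rule lessThan_iff[THEN iffD2])
  qed (use level_freq_pos[of r] in \<open>auto simp: g_def\<close>)
  also have "\<dots> \<le> 4 / (2 ^ r)\<^sup>2 * (\<Sum>j<(2::nat) ^ r. 2 * (4 ^ r * 100 * (real r + 2)\<^sup>2))"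
    using g_sum by (intro mult_left_mono sum_mono) auto
  also have "\<dots> = 800 * (real r + 2)\<^sup>2 * 2 ^ r"
  proof -
    have "4 ^ r = (2 ^ r) * (2 ^ r :: real)" by (simp flip: power_mult_distrib)
    then show ?thesis by (simp add: power2_eq_square)
  qed
  finally show ?thesis .
qed

text \<open>The origin of the dimension 1/2: the expected count grows like \<open>2 ^ r\<close> up
  to a polynomial factor, and \<open>2 * (1 / 4) powr s\<close> is below 1 exactly when
  \<open>s\<close> exceeds 1/2.\<close>

lemma AE_level_sum:
  assumes s: "1 / 2 < s"
  shows "AE \<omega> in M. (\<lambda>r. level_sum r (B \<omega>) * (1 / 4 ^ r) powr s) \<longlonglongrightarrow> 0"
proof (rule AE_tendsto_zero_if_summable)
  have int: "integrable M (\<lambda>\<omega>. level_sum r (B \<omega>))" for r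
    unfolding level_sum_def using integrable_osc_sum by auto
  then show "integrable M (\<lambda>\<omega>. level_sum r (B \<omega>) * (1 / 4 ^ r) powr s)" for r by auto
  show "0 \<le> level_sum r (B \<omega>) * (1 / 4 ^ r) powr s" for r \<omega>
    by (simp add: level_sum_nonneg)
  define q where "q = 2 * (1 / 4) powr s"
  have "(1 / 4 :: real) powr s < (1 / 4) powr (1 / 2)" using s by (intro powr_less_mono') auto
  also have "\<dots> = 1 / 2" by (simp add: powr_half_sqrt real_sqrt_divide)
  finally have q: "0 < q" "q < 1" by (auto simp: q_def)
  have le: "expectation (\<lambda>\<omega>. level_sum r (B \<omega>) * (1 / 4 ^ r) powr s) \<le> 800 * ((real r + 2)\<^sup>2 * q ^ r)" for r
  proof -
    have "(1 / 4 ^ r) powr s = ((1 / 4) powr s) ^ r"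
      by (simp add: powr_realpow[symmetric] powr_powr powr_divide mult.commute power_one_over[symmetric] del: power_one_over)
    then have "expectation (\<lambda>\<omega>. level_sum r (B \<omega>) * (1 / 4 ^ r) powr s) = expectation (\<lambda>\<omega>. level_sum r (B \<omega>)) * ((1 / 4) powr s) ^ r"
      by simp
    also have "\<dots> \<le> 800 * (real r + 2)\<^sup>2 * 2 ^ r * ((1 / 4) powr s) ^ r"
      by (intro mult_right_mono expectation_level_sum) auto
    finally show ?thesis by (simp add: q_def power_mult_distrib mult.assoc)
  qed
  show "summable (\<lambda>r. expectation (\<lambda>\<omega>. level_sum r (B \<omega>) * (1 / 4 ^ r) powr s))"
  proof (rule summable_comparison_test'[OF summable_mult[OF summable_poly_geometric[OF q], of 800]])
    fix r :: nat
    have "0 \<le> expectation (\<lambda>\<omega>. level_sum r (B \<omega>) * (1 / 4 ^ r) powr s)"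
      by (intro integral_nonneg_AE AE_I2 mult_nonneg_nonneg level_sum_nonneg) auto
    with le[of r] show "norm (expectation (\<lambda>\<omega>. level_sum r (B \<omega>) * (1 / 4 ^ r) powr s)) \<le> 800 * ((real r + 2)\<^sup>2 * q ^ r)"
      by simp
  qed
qed

end

subsection \<open>Three consecutive small increments\<close>

text \<open>A majorant of the indicator that all three increments are at most
  \<open>1 / (N * \<theta>)\<close> in modulus. Being a trigonometric polynomial, it has a mean
  expressible through Gaussian cosines.\<close>

definition fejer_triple :: "nat \<Rightarrow> real \<Rightarrow> real \<Rightarrow> (real \<Rightarrow> real) \<Rightarrow> real \<Rightarrow> real" where
  "fejer_triple N \<theta> h f t = fejer N \<theta> (f (t + h) - f t) * fejer N \<theta> (f (t + 2 * h) - f (t + h)) *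
     fejer N \<theta> (f (t + 3 * h) - f (t + 2 * h))"

text \<open>The condition on \<open>k\<close> keeps all four grid points in [0,1]. With
  \<open>\<theta> = 1 / K\<close> the window is \<open>K / 4 ^ r\<close>, the size of increments
  with Lipschitz constant \<open>K\<close>.\<close>

definition triple_sum :: "nat \<Rightarrow> real \<Rightarrow> (real \<Rightarrow> real) \<Rightarrow> real" where
  "triple_sum r \<theta> f = (\<Sum>k | k + 3 \<le> 4 ^ r. fejer_triple (4 ^ r) \<theta> (1 / 4 ^ r) f (real k / 4 ^ r))"

lemma fejer_triple_nonneg: "0 \<le> fejer_triple N \<theta> h f t"
  by (simp add: fejer_triple_def fejer_nonneg)

lemma triple_sum_nonneg: "0 \<le> triple_sum r \<theta> f"
  unfolding triple_sum_def by (intro sum_nonneg fejer_triple_nonneg)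

text \<open>Reduces the mean of a product of cosines of dependent Gaussians to means of cosines of
  single Gaussian combinations.\<close>

lemma cos_triple_product:
  "cos a * cos b * cos c = (cos (a + b + c) + cos (a + b - c) + cos (a - b + c) + cos (a - b - c)) / (4::real)"
  by (simp add: cos_add cos_diff sin_add sin_diff algebra_simps)

lemma sum_triple_product:
  fixes f g h :: "'i \<Rightarrow> real"
  shows "(\<Sum>p\<in>P. f p) * (\<Sum>q\<in>P. g q) * (\<Sum>s\<in>P. h s) = (\<Sum>p\<in>P. \<Sum>q\<in>P. \<Sum>s\<in>P. f p * g q * h s)"
proof -
  have "(\<Sum>p\<in>P. f p) * (\<Sum>q\<in>P. g q) * (\<Sum>s\<in>P. h s) = (\<Sum>p\<in>P. \<Sum>q\<in>P. f p * g q) * (\<Sum>s\<in>P. h s)"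
    by (simp only: sum_product)
  also have "\<dots> = (\<Sum>p\<in>P. \<Sum>q\<in>P. f p * g q * (\<Sum>s\<in>P. h s))"
    by (simp only: sum_distrib_right)
  also have "\<dots> = (\<Sum>p\<in>P. \<Sum>q\<in>P. \<Sum>s\<in>P. f p * g q * h s)"
    by (simp only: sum_distrib_left)
  finally show ?thesis .
qed

text \<open>Completing a square gives \<open>- u\<^sup>2 \<le> 1 / 4 - u\<close>, so Gaussian
  weights are at most twice exponential ones and \<open>sum_exp_dist_le\<close> applies.\<close>

lemma sum_gauss_weight_le:
  assumes \<theta>: "0 < \<theta>" and h: "0 < h"
  shows "(\<Sum>j<N. \<Sum>l<N. exp (- h * ((real j - real l) * \<theta>)\<^sup>2 / 8)) \<le> 4 * real N * (1 + 3 / (\<theta> * sqrt h))"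
proof -
  \<comment> \<open>With the divisor 3, \<open>u\<^sup>2\<close> carries the factor 1/9, below the
    1/8 of the weight.\<close>
  define x where "x = \<theta> * sqrt h / 3"
  have x: "0 < x" using assms by (simp add: x_def)
  have "exp (- h * ((real j - real l) * \<theta>)\<^sup>2 / 8) \<le> 2 * exp (- x * real (nat \<bar>int j - int l\<bar>))" for j l
  proof -
    define u where "u = x * real (nat \<bar>int j - int l\<bar>)"
    have "u\<^sup>2 = h * ((real j - real l) * \<theta>)\<^sup>2 / 9"
      using h by (simp add: u_def x_def power_mult_distrib power_divide)
    also have "\<dots> \<le> h * ((real j - real l) * \<theta>)\<^sup>2 / 8" using h by simp
    finally have "- h * ((real j - real l) * \<theta>)\<^sup>2 / 8 \<le> - u\<^sup>2" by simp
    also have "- u\<^sup>2 \<le> 1 / 4 - u" using zero_le_power2[of "u - 1/2"] by (simp add: power2_diff power_divide)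
    finally have "exp (- h * ((real j - real l) * \<theta>)\<^sup>2 / 8) \<le> exp (1 / 4) * exp (- u)"
      by (simp flip: exp_add)
    also have "\<dots> \<le> 2 * exp (- u)"
    proof (intro mult_right_mono)
      have "exp (1 / 4) \<le> exp (1 / 2 :: real)" by simp
      also have "\<dots> \<le> 2" using exp_bound_half[of "1/2::real"] by simp
      finally show "exp (1 / 4) \<le> (2::real)" .
    qed simp
    finally show ?thesis by (simp add: u_def)
  qed
  then have "(\<Sum>j<N. \<Sum>l<N. exp (- h * ((real j - real l) * \<theta>)\<^sup>2 / 8))
      \<le> (\<Sum>j<N. \<Sum>l<N. 2 * exp (- x * real (nat \<bar>int j - int l\<bar>)))"
    by (intro sum_mono)
  also have "\<dots> = (\<Sum>j<N. 2 * (\<Sum>l<N. exp (- x * real (nat \<bar>int j - int l\<bar>))))"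
    by (simp add: sum_distrib_left)
  also have "\<dots> \<le> (\<Sum>j<N. 2 * (2 * (1 + 1 / x)))"
    using x by (intro sum_mono mult_left_mono sum_exp_dist_le) auto
  also have "\<dots> = 4 * real N * (1 + 3 / (\<theta> * sqrt h))" by (simp add: x_def)
  finally show ?thesis .
qed

context bridge begin

context
  fixes t h :: real
  assumes t: "0 \<le> t" and h: "0 < h" "h \<le> 1 / 4" and th: "t + 3 * h \<le> 1"
begin

lemma measurable_three_points [measurable]:
  "(\<lambda>\<omega>. B \<omega> t) \<in> borel_measurable M" "(\<lambda>\<omega>. B \<omega> (t + h)) \<in> borel_measurable M"
  "(\<lambda>\<omega>. B \<omega> (t + 2 * h)) \<in> borel_measurable M" "(\<lambda>\<omega>. B \<omega> (t + 3 * h)) \<in> borel_measurable M"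
  using t h th by (auto intro!: measurable_B)

text \<open>For \<open>h \<le> 1 / 4\<close> the pinning costs at most three quarters of the
  variance that independent increments would give. The remaining quarter yields a bound that
  factorises and is the same for all four sign choices.\<close>

lemma expectation_cos_triple:
  "expectation (\<lambda>\<omega>. cos (a * (B \<omega> (t + h) - B \<omega> t)) * cos (b * (B \<omega> (t + 2 * h) - B \<omega> (t + h))) *
      cos (c * (B \<omega> (t + 3 * h) - B \<omega> (t + 2 * h))))
    \<le> exp (- h * a\<^sup>2 / 8) * exp (- h * b\<^sup>2 / 8) * exp (- h * c\<^sup>2 / 8)"
proof -
  define Y where "Y a b c \<omega> = a * (B \<omega> (t + h) - B \<omega> t) + b * (B \<omega> (t + 2 * h) - B \<omega> (t + h)) +
      c * (B \<omega> (t + 3 * h) - B \<omega> (t + 2 * h))" for a b c \<omega>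
  have [measurable]: "Y a b c \<in> borel_measurable M" for a b c
    unfolding Y_def by measurable
  have int: "integrable M (\<lambda>\<omega>. cos (Y a b c \<omega>))" for a b c
    by (rule integrable_const_bound[where B = 1]) auto
  have E: "expectation (\<lambda>\<omega>. cos (Y a b c \<omega>)) \<le> exp (- h * (a\<^sup>2 + b\<^sup>2 + c\<^sup>2) / 8)" for a b c
  proof -
    define S where "S = a\<^sup>2 + b\<^sup>2 + c\<^sup>2"
    define v where "v = h * S - h\<^sup>2 * (a + b + c)\<^sup>2"
    \<comment> \<open>This sum of squares equals \<open>3 * S - (a + b + c)\<^sup>2\<close>.\<close>
    have "0 \<le> (a - b)\<^sup>2 + (b - c)\<^sup>2 + (a - c)\<^sup>2" by simp
    then have "(a + b + c)\<^sup>2 \<le> 3 * S" by (simp add: S_def power2_eq_square algebra_simps)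
    then have "h\<^sup>2 * (a + b + c)\<^sup>2 \<le> h\<^sup>2 * (3 * S)" by (intro mult_left_mono) auto
    also have "\<dots> = h * (h * (3 * S))" by (simp add: power2_eq_square)
    also have "\<dots> \<le> h * (1 / 4 * (3 * S))"
      using h by (intro mult_left_mono mult_right_mono) (auto simp: S_def)
    also have "\<dots> = 3 / 4 * (h * S)" by simp
    finally have v: "h * S / 4 \<le> v" unfolding v_def by linarith
    have S: "0 \<le> h * S" using h by (simp add: S_def)
    have "centered_gaussian M (Y a b c) v"
      using gaussian_three_increments[of t h a b c] t h th by (simp add: Y_def[abs_def] v_def S_def)
    then have "expectation (\<lambda>\<omega>. cos (Y a b c \<omega>)) = exp (- v / 2)"
      using v S by (intro expectation_cos_gaussian) auto
    also have "\<dots> \<le> exp (- h * S / 8)" using v by (simp add: mult.commute)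
    finally show ?thesis by (simp add: S_def)
  qed
  have "expectation (\<lambda>\<omega>. cos (a * (B \<omega> (t + h) - B \<omega> t)) * cos (b * (B \<omega> (t + 2 * h) - B \<omega> (t + h))) *
      cos (c * (B \<omega> (t + 3 * h) - B \<omega> (t + 2 * h)))) =
      expectation (\<lambda>\<omega>. (cos (Y a b c \<omega>) + cos (Y a b (- c) \<omega>) + cos (Y a (- b) c \<omega>) + cos (Y a (- b) (- c) \<omega>)) / 4)"
    by (simp add: cos_triple_product Y_def)
  also have "\<dots> = (expectation (\<lambda>\<omega>. cos (Y a b c \<omega>)) + expectation (\<lambda>\<omega>. cos (Y a b (- c) \<omega>)) +
      expectation (\<lambda>\<omega>. cos (Y a (- b) c \<omega>)) + expectation (\<lambda>\<omega>. cos (Y a (- b) (- c) \<omega>))) / 4"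
    using int by (simp add: Bochner_Integration.integral_add)
  also have "\<dots> \<le> exp (- h * (a\<^sup>2 + b\<^sup>2 + c\<^sup>2) / 8)"
    using E[of a b c] E[of a b "-c"] E[of a "-b" c] E[of a "-b" "-c"] by simp
  also have "\<dots> = exp (- h * a\<^sup>2 / 8) * exp (- h * b\<^sup>2 / 8) * exp (- h * c\<^sup>2 / 8)"
    by (simp add: algebra_simps add_divide_distrib diff_divide_distrib flip: exp_add)
  finally show ?thesis .
qed

text \<open>Three kernels multiply out to a triple sum over pairs of indices. The factorised bound
  on each mean lets the sum fold back into the cube of a one-kernel estimate.\<close>

lemma fejer_triple_integral:
  assumes N: "0 < N" and \<theta>: "0 < \<theta>"
  shows "integrable M (\<lambda>\<omega>. fejer_triple N \<theta> h (B \<omega>) t)"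
    and "expectation (\<lambda>\<omega>. fejer_triple N \<theta> h (B \<omega>) t) \<le> (16 * (1 + 3 / (\<theta> * sqrt h)) / real N) ^ 3"
proof -
  define P where "P = {..<N} \<times> {..<N}"
  define w where "w p = (real (fst p) - real (snd p)) * \<theta>" for p :: "nat \<times> nat"
  define e where "e p = exp (- h * (w p)\<^sup>2 / 8)" for p
  define X1 X2 X3 where "X1 \<omega> = B \<omega> (t + h) - B \<omega> t" "X2 \<omega> = B \<omega> (t + 2 * h) - B \<omega> (t + h)"
    "X3 \<omega> = B \<omega> (t + 3 * h) - B \<omega> (t + 2 * h)" for \<omega>
  have [measurable]: "X1 \<in> borel_measurable M" "X2 \<in> borel_measurable M" "X3 \<in> borel_measurable M"
    unfolding X1_X2_X3_def by measurable
  have fejer: "fejer N \<theta> y = 4 / (real N)\<^sup>2 * (\<Sum>p\<in>P. cos (w p * y))" for y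
    by (simp add: fejer_def P_def w_def sum.cartesian_product case_prod_beta)
  have eq: "fejer_triple N \<theta> h (B \<omega>) t = (4 / (real N)\<^sup>2) ^ 3 *
      (\<Sum>p\<in>P. \<Sum>q\<in>P. \<Sum>s\<in>P. cos (w p * X1 \<omega>) * cos (w q * X2 \<omega>) * cos (w s * X3 \<omega>))" for \<omega>
    unfolding sum_triple_product[symmetric] fejer_triple_def fejer X1_X2_X3_def by (simp add: power3_eq_cube)
  have int: "integrable M (\<lambda>\<omega>. cos (w p * X1 \<omega>) * cos (w q * X2 \<omega>) * cos (w s * X3 \<omega>))" for p q s
    by (rule integrable_const_bound[where B = 1]) (auto simp: abs_mult intro!: mult_le_one)
  show "integrable M (\<lambda>\<omega>. fejer_triple N \<theta> h (B \<omega>) t)"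
    unfolding eq by (intro integrable_mult_right Bochner_Integration.integrable_sum int)
  have "expectation (\<lambda>\<omega>. fejer_triple N \<theta> h (B \<omega>) t) = (4 / (real N)\<^sup>2) ^ 3 *
      (\<Sum>p\<in>P. \<Sum>q\<in>P. \<Sum>s\<in>P. expectation (\<lambda>\<omega>. cos (w p * X1 \<omega>) * cos (w q * X2 \<omega>) * cos (w s * X3 \<omega>)))"
    unfolding eq using int by (simp add: Bochner_Integration.integral_sum)
  also have "\<dots> \<le> (4 / (real N)\<^sup>2) ^ 3 * (\<Sum>p\<in>P. \<Sum>q\<in>P. \<Sum>s\<in>P. e p * e q * e s)"
    unfolding e_def X1_X2_X3_def by (intro mult_left_mono sum_mono expectation_cos_triple) auto
  also have "\<dots> = (4 / (real N)\<^sup>2 * (\<Sum>p\<in>P. e p)) ^ 3"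
    unfolding sum_triple_product[symmetric] by (simp add: power3_eq_cube)
  also have "\<dots> \<le> (4 / (real N)\<^sup>2 * (4 * real N * (1 + 3 / (\<theta> * sqrt h)))) ^ 3"
  proof (intro power_mono mult_left_mono)
    have "(\<Sum>p\<in>P. e p) = (\<Sum>j<N. \<Sum>l<N. exp (- h * ((real j - real l) * \<theta>)\<^sup>2 / 8))"
      by (simp add: P_def e_def w_def sum.cartesian_product case_prod_beta)
    also have "\<dots> \<le> 4 * real N * (1 + 3 / (\<theta> * sqrt h))"
      by (rule sum_gauss_weight_le[OF \<theta> h(1)])
    finally show "(\<Sum>p\<in>P. e p) \<le> 4 * real N * (1 + 3 / (\<theta> * sqrt h))" .
  qed (auto simp: e_def intro!: divide_nonneg_nonneg mult_nonneg_nonneg sum_nonneg)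
  also have "4 / (real N)\<^sup>2 * (4 * real N * (1 + 3 / (\<theta> * sqrt h))) = 16 * (1 + 3 / (\<theta> * sqrt h)) / real N"
    using N by (simp add: power2_eq_square)
  finally show "expectation (\<lambda>\<omega>. fejer_triple N \<theta> h (B \<omega>) t) \<le> (16 * (1 + 3 / (\<theta> * sqrt h)) / real N) ^ 3" .
qed

end

text \<open>Each position contributes at most the cube of \<open>64 * K / 2 ^ r\<close>, and there
  are fewer than \<open>4 ^ r\<close> positions, which leaves the summable
  \<open>(1 / 2) ^ r\<close>. With two increments the same count would give only a constant.\<close>

lemma AE_triple_sum:
  assumes K: "1 \<le> K"
  shows "AE \<omega> in M. (\<lambda>r. triple_sum r (1 / K) (B \<omega>)) \<longlonglongrightarrow> 0"
proof -
  have grid: "0 \<le> real k / 4 ^ r" "(0::real) < 1 / 4 ^ r" "1 / 4 ^ r \<le> (1 / 4 :: real)" "real k / 4 ^ r + 3 * (1 / 4 ^ r) \<le> 1"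
    if "k + 3 \<le> 4 ^ r" for k r :: nat
  proof -
    show "1 / 4 ^ r \<le> (1 / 4 :: real)" using that by (cases r) auto
    have "real (k + 3) \<le> real (4 ^ r)" using that by (subst of_nat_le_iff)
    then show "real k / 4 ^ r + 3 * (1 / 4 ^ r) \<le> 1"
      by (simp add: add_divide_distrib[symmetric] add.commute)
  qed auto
  have fin: "finite {k. k + 3 \<le> (4::nat) ^ r}" for r
    by (rule finite_subset[of _ "{..4 ^ r}"]) auto
  have int: "integrable M (\<lambda>\<omega>. fejer_triple (4 ^ r) (1 / K) (1 / 4 ^ r) (B \<omega>) (real k / 4 ^ r))"
    if "k + 3 \<le> 4 ^ r" for k r
    using fejer_triple_integral(1)[OF grid[OF that]] K by simp
  have one: "expectation (\<lambda>\<omega>. fejer_triple (4 ^ r) (1 / K) (1 / 4 ^ r) (B \<omega>) (real k / 4 ^ r)) \<le> (64 * K / 2 ^ r) ^ 3"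
    if "k + 3 \<le> 4 ^ r" for k r
  proof -
    have four: "(4::real) ^ r = 2 ^ r * 2 ^ r" by (simp flip: power_mult_distrib)
    have "expectation (\<lambda>\<omega>. fejer_triple (4 ^ r) (1 / K) (1 / 4 ^ r) (B \<omega>) (real k / 4 ^ r))
        \<le> (16 * (1 + 3 / (1 / K * sqrt (1 / 4 ^ r))) / real (4 ^ r)) ^ 3"
      using fejer_triple_integral(2)[OF grid[OF that], of "4 ^ r" "1 / K"] K by simp
    also have "\<dots> \<le> (16 * (4 * K * 2 ^ r) / 4 ^ r) ^ 3"
    proof -
      have "sqrt (1 / 4 ^ r) = 1 / 2 ^ r" unfolding four by (simp add: real_sqrt_divide)
      \<comment> \<open>Absorbs the summand 1 into \<open>4 * K * 2 ^ r\<close>.\<close>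
      moreover have "1 * 1 \<le> K * 2 ^ r" using K by (intro mult_mono) auto
      ultimately have "1 + 3 / (1 / K * sqrt (1 / 4 ^ r)) \<le> 4 * K * 2 ^ r" by simp
      then show ?thesis using K
        by (intro power_mono) (auto intro!: divide_right_mono divide_nonneg_nonneg mult_nonneg_nonneg add_nonneg_nonneg)
    qed
    also have "16 * (4 * K * 2 ^ r) / 4 ^ r = 64 * K / 2 ^ r" unfolding four by simp
    finally show ?thesis .
  qed
  show ?thesis
  proof (rule AE_tendsto_zero_if_summable)
    show "integrable M (\<lambda>\<omega>. triple_sum r (1 / K) (B \<omega>))" for r
      unfolding triple_sum_def using int by (intro Bochner_Integration.integrable_sum) auto
    show "0 \<le> triple_sum r (1 / K) (B \<omega>)" for r \<omega> by (rule triple_sum_nonneg)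
    have le: "expectation (\<lambda>\<omega>. triple_sum r (1 / K) (B \<omega>)) \<le> (64 * K) ^ 3 * (1 / 2) ^ r" for r
    proof -
      have "expectation (\<lambda>\<omega>. triple_sum r (1 / K) (B \<omega>)) =
          (\<Sum>k | k + 3 \<le> 4 ^ r. expectation (\<lambda>\<omega>. fejer_triple (4 ^ r) (1 / K) (1 / 4 ^ r) (B \<omega>) (real k / 4 ^ r)))"
        unfolding triple_sum_def using int by (intro Bochner_Integration.integral_sum) auto
      also have "\<dots> \<le> (\<Sum>k | k + 3 \<le> (4::nat) ^ r. (64 * K / 2 ^ r) ^ 3)"
        using one by (intro sum_mono) auto
      also have "\<dots> \<le> (\<Sum>k<(4::nat) ^ r. (64 * K / 2 ^ r) ^ 3)"
        using K by (intro sum_mono2) auto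
      also have "\<dots> = (64 * K) ^ 3 * (1 / 2) ^ r"
      proof -
        have four: "(4::real) ^ r = 2 ^ r * 2 ^ r" by (simp flip: power_mult_distrib)
        show ?thesis by (simp add: four power_divide power3_eq_cube)
      qed
      finally show ?thesis .
    qed
    have "summable (\<lambda>r. (64 * K) ^ 3 * (1 / 2) ^ r :: real)" by (intro summable_mult summable_geometric) auto
    then show "summable (\<lambda>r. expectation (\<lambda>\<omega>. triple_sum r (1 / K) (B \<omega>)))"
    proof (rule summable_comparison_test')
      fix r :: nat
      have "0 \<le> expectation (\<lambda>\<omega>. triple_sum r (1 / K) (B \<omega>))"
        by (intro integral_nonneg_AE AE_I2 triple_sum_nonneg)
      with le[of r] show "norm (expectation (\<lambda>\<omega>. triple_sum r (1 / K) (B \<omega>))) \<le> (64 * K) ^ 3 * (1 / 2) ^ r" by simp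
    qed
  qed
qed

end

section \<open>Absence of one-sided Lipschitz points\<close>

lemma no_close_triples:
  assumes lim: "\<And>K::nat. 1 \<le> K \<Longrightarrow> (\<lambda>r. triple_sum r (1 / real K) f) \<longlonglongrightarrow> 0"
    and close: "\<forall>\<^sub>F r in sequentially. \<exists>k. k + 3 \<le> 4 ^ r \<and> (\<forall>i\<le>3. \<bar>f (real (k + i) / 4 ^ r) - y\<bar> \<le> C / 4 ^ r)"
  shows False
proof -
  \<comment> \<open>Two values within \<open>C / 4 ^ r\<close> of \<open>y\<close> differ by at most
    \<open>2 * C / 4 ^ r\<close>, so with this \<open>K\<close> all three kernels are at least 1.
    Integer constants keep the number of almost sure conditions countable.\<close>
  obtain K :: nat where K: "max 1 (2 * C) \<le> real K" using real_arch_simple by blast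
  then have K1: "1 \<le> K" by simp
  have "\<forall>\<^sub>F r in sequentially. triple_sum r (1 / real K) f < 1"
    using lim[OF K1] by (rule order_tendstoD) simp
  with close have "\<forall>\<^sub>F r in sequentially. False"
  proof eventually_elim
    case (elim r)
    then obtain k where k: "k + 3 \<le> 4 ^ r" and fk: "\<And>i. i \<le> 3 \<Longrightarrow> \<bar>f (real (k + i) / 4 ^ r) - y\<bar> \<le> C / 4 ^ r"
      by blast
    let ?t = "real k / 4 ^ r" and ?h = "1 / 4 ^ r :: real"
    have pt: "real (k + i) / 4 ^ r = ?t + real i * ?h" for i by (simp add: add_divide_distrib)
    have f1: "1 \<le> fejer (4 ^ r) (1 / real K) (f (?t + real i * ?h) - f (?t + real j * ?h))" if "i \<le> 3" "j \<le> 3" for i j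
    proof (rule fejer_ge_1)
      have "\<bar>f (?t + real i * ?h) - f (?t + real j * ?h)\<bar> \<le> 2 * C / 4 ^ r"
        using fk[OF that(1)] fk[OF that(2)] unfolding pt by linarith
      also have "\<dots> \<le> real K / 4 ^ r" using K by (intro divide_right_mono) auto
      finally show "\<bar>1 / real K * (f (?t + real i * ?h) - f (?t + real j * ?h))\<bar> \<le> 1 / real (4 ^ r)"
        using K1 by (simp add: field_simps)
    qed simp
    have "1 * 1 * 1 \<le> fejer_triple (4 ^ r) (1 / real K) ?h f ?t"
      unfolding fejer_triple_def using f1[of 1 0] f1[of 2 1] f1[of 3 2]
      by (intro mult_mono) (auto simp: fejer_nonneg)
    also have "\<dots> \<le> triple_sum r (1 / real K) f"
      unfolding triple_sum_def
    proof (rule member_le_sum[where f = "\<lambda>k. fejer_triple (4 ^ r) (1 / real K) (1 / 4 ^ r) f (real k / 4 ^ r)"])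
      show "finite {k. k + 3 \<le> (4::nat) ^ r}"
        by (rule finite_subset[of _ "{..4 ^ r}"]) auto
    qed (use k in \<open>auto simp: fejer_triple_nonneg\<close>)
    finally show False using elim by simp
  qed
  then show False by simp
qed

lemma eventually_inverse_power_less: "0 < \<epsilon> \<Longrightarrow> \<forall>\<^sub>F r in sequentially. 4 / 4 ^ r < (\<epsilon>::real)"
proof -
  assume "0 < \<epsilon>"
  have "(\<lambda>r. 4 / 4 ^ r :: real) \<longlonglongrightarrow> 0" by real_asymp
  then show ?thesis using \<open>0 < \<epsilon>\<close> by (rule order_tendstoD)
qed

lemma not_lipschitz_right:
  assumes lim: "\<And>K::nat. 1 \<le> K \<Longrightarrow> (\<lambda>r. triple_sum r (1 / real K) f) \<longlonglongrightarrow> 0"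
    and x: "0 \<le> x" "x < 1" and \<delta>: "0 < \<delta>"
    and lip: "\<And>t. x < t \<Longrightarrow> t \<le> 1 \<Longrightarrow> t < x + \<delta> \<Longrightarrow> \<bar>f t - f x\<bar> \<le> L * \<bar>t - x\<bar>" and L: "0 \<le> L"
  shows False
proof (rule no_close_triples[OF lim])
  have "0 < min \<delta> (1 - x)" using x \<delta> by simp
  from eventually_inverse_power_less[OF this]
  show "\<forall>\<^sub>F r in sequentially. \<exists>k. k + 3 \<le> 4 ^ r \<and> (\<forall>i\<le>3. \<bar>f (real (k + i) / 4 ^ r) - f x\<bar> \<le> L * 4 / 4 ^ r)"
  proof eventually_elim
    case (elim r)
    then have e: "4 / 4 ^ r < \<delta>" "4 / 4 ^ r < 1 - x" by auto
    \<comment> \<open>The first grid index strictly to the right of \<open>x\<close>; strictness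
      matters because the Lipschitz bound is assumed only for \<open>t > x\<close>.\<close>
    define k where "k = nat \<lfloor>x * 4 ^ r\<rfloor> + 1"
    have "real k = real_of_int \<lfloor>x * 4 ^ r\<rfloor> + 1" using x by (simp add: k_def)
    then have k: "x * 4 ^ r < real k" "real k \<le> x * 4 ^ r + 1" by linarith+
    have near: "x < real (k + i) / 4 ^ r \<and> real (k + i) / 4 ^ r \<le> x + 4 / 4 ^ r" if "i \<le> 3" for i
    proof
      have "x * 4 ^ r < real (k + i)" using k by simp
      then show "x < real (k + i) / 4 ^ r" by (simp add: field_simps)
      have "real (k + i) \<le> x * 4 ^ r + 4" using k that by simp
      then have "real (k + i) / 4 ^ r \<le> (x * 4 ^ r + 4) / 4 ^ r" by (intro divide_right_mono) auto
      then show "real (k + i) / 4 ^ r \<le> x + 4 / 4 ^ r" by (simp add: add_divide_distrib)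
    qed
    have le1: "real (k + i) / 4 ^ r < 1" "real (k + i) / 4 ^ r < x + \<delta>" if "i \<le> 3" for i
      using near[OF that] e by linarith+
    have "\<bar>f (real (k + i) / 4 ^ r) - f x\<bar> \<le> L * 4 / 4 ^ r" if "i \<le> 3" for i
    proof -
      have "\<bar>f (real (k + i) / 4 ^ r) - f x\<bar> \<le> L * \<bar>real (k + i) / 4 ^ r - x\<bar>"
        using near[OF that] le1[OF that] by (intro lip) auto
      also have "\<dots> \<le> L * (4 / 4 ^ r)" using near[OF that] L by (intro mult_left_mono) auto
      finally show ?thesis by simp
    qed
    moreover have "real (k + 3) < real (4 ^ r)" using le1[of 3] by (simp add: field_simps)
    then have "k + 3 \<le> 4 ^ r" by (simp only: of_nat_less_iff less_imp_le)
    ultimately show ?case by blast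
  qed
qed

lemma not_lipschitz_left:
  assumes lim: "\<And>K::nat. 1 \<le> K \<Longrightarrow> (\<lambda>r. triple_sum r (1 / real K) f) \<longlonglongrightarrow> 0"
    and x: "0 < x" "x \<le> 1" and \<delta>: "0 < \<delta>"
    and lip: "\<And>t. 0 \<le> t \<Longrightarrow> t < x \<Longrightarrow> x - \<delta> < t \<Longrightarrow> \<bar>f t - f x\<bar> \<le> L * \<bar>t - x\<bar>" and L: "0 \<le> L"
  shows False
proof (rule no_close_triples[OF lim])
  have "0 < min \<delta> x" using x \<delta> by simp
  from eventually_inverse_power_less[OF this]
  show "\<forall>\<^sub>F r in sequentially. \<exists>k. k + 3 \<le> 4 ^ r \<and> (\<forall>i\<le>3. \<bar>f (real (k + i) / 4 ^ r) - f x\<bar> \<le> L * 4 / 4 ^ r)"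
  proof eventually_elim
    case (elim r)
    \<comment> \<open>Chosen so that \<open>k + 3\<close> is the last grid index strictly to the
      left of \<open>x\<close>; \<open>4 < x * 4 ^ r\<close> below ensures that \<open>nat\<close>
      does not truncate.\<close>
    define k where "k = nat (\<lceil>x * 4 ^ r\<rceil> - 4)"
    have "4 < x * 4 ^ r" using elim by (simp add: field_simps)
    then have "real k = real_of_int \<lceil>x * 4 ^ r\<rceil> - 4" unfolding k_def by (subst of_nat_nat) linarith+
    then have k: "x * 4 ^ r \<le> real k + 4" "real k + 3 < x * 4 ^ r" by linarith+
    have near: "real (k + i) / 4 ^ r < x \<and> x - 4 / 4 ^ r \<le> real (k + i) / 4 ^ r" if "i \<le> 3" for i
    proof
      have "real (k + i) < x * 4 ^ r" using k that by simp
      then show "real (k + i) / 4 ^ r < x" by (simp add: field_simps)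
      have "x * 4 ^ r - 4 \<le> real (k + i)" using k by simp
      then have "(x * 4 ^ r - 4) / 4 ^ r \<le> real (k + i) / 4 ^ r" by (intro divide_right_mono) auto
      then show "x - 4 / 4 ^ r \<le> real (k + i) / 4 ^ r" by (simp add: diff_divide_distrib)
    qed
    have "\<bar>f (real (k + i) / 4 ^ r) - f x\<bar> \<le> L * 4 / 4 ^ r" if "i \<le> 3" for i
    proof -
      have "\<bar>f (real (k + i) / 4 ^ r) - f x\<bar> \<le> L * \<bar>real (k + i) / 4 ^ r - x\<bar>"
        using near[OF that] elim by (intro lip) auto
      also have "\<dots> \<le> L * (4 / 4 ^ r)" using near[OF that] L by (intro mult_left_mono) auto
      finally show ?thesis by simp
    qed
    moreover have "real (k + 3) < real (4 ^ r)"
    proof -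
      have "x * 4 ^ r \<le> 1 * 4 ^ r" using x by (intro mult_right_mono) auto
      then have "real k + 3 < 4 ^ r" using k by linarith
      then show ?thesis by simp
    qed
    then have "k + 3 \<le> 4 ^ r" by (simp only: of_nat_less_iff less_imp_le)
    ultimately show ?case by blast
  qed
qed

subsection \<open>Pathwise consequences\<close>

lemma grid_chain:
  assumes inc: "\<And>k. k < 4 ^ m \<Longrightarrow> \<bar>f ((real k + 1) / 4 ^ m) - f (real k / 4 ^ m)\<bar> \<le> (\<epsilon>::real)"
    and "b + i \<le> 4 ^ m"
  shows "\<bar>f (real (b + i) / 4 ^ m) - f (real b / 4 ^ m)\<bar> \<le> real i * \<epsilon>"
  using assms(2)
proof (induction i)
  case (Suc i)
  then have "\<bar>f (real (b + i) / 4 ^ m) - f (real b / 4 ^ m)\<bar> \<le> real i * \<epsilon>"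
    and "\<bar>f ((real (b + i) + 1) / 4 ^ m) - f (real (b + i) / 4 ^ m)\<bar> \<le> \<epsilon>"
    using inc[of "b + i"] by simp_all
  moreover have e: "real (b + Suc i) = real (b + i) + 1" "real (Suc i) * \<epsilon> = real i * \<epsilon> + \<epsilon>"
    by (simp_all add: algebra_simps)
  ultimately show ?case unfolding e by linarith
qed simp

text \<open>Chaining: \<open>t\<close> is approximated from below by its 4-adic truncations. Passing
  to the next truncation crosses at most three cells of the finer grid, and continuity carries the
  summed bound to the limit.\<close>

lemma grid_modulus_imp_modulus:
  fixes f :: "real \<Rightarrow> real"
  assumes cont: "continuous_on {0..1} f"
    and inc: "\<And>m k. r \<le> m \<Longrightarrow> k < 4 ^ m \<Longrightarrow>
      \<bar>f ((real k + 1) / 4 ^ m) - f (real k / 4 ^ m)\<bar> \<le> 4 * real m / 2 ^ m"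
    and t: "t \<in> {0..1}"
  shows "\<bar>f t - f (real (nat \<lfloor>t * 4 ^ r\<rfloor>) / 4 ^ r)\<bar> \<le> 12 * (real r + 2) / 2 ^ r"
proof -
  define a where "a n = nat \<lfloor>t * 4 ^ n\<rfloor>" for n
  have a: "real (a n) \<le> t * 4 ^ n" "t * 4 ^ n < real (a n) + 1" for n
  proof -
    have "real (a n) = real_of_int \<lfloor>t * 4 ^ n\<rfloor>" using t by (simp add: a_def)
    then show "real (a n) \<le> t * 4 ^ n" "t * 4 ^ n < real (a n) + 1" by linarith+
  qed
  have a4: "a n \<le> 4 ^ n" for n
  proof -
    have "t * 4 ^ n \<le> 1 * 4 ^ n" using t by (intro mult_right_mono) auto
    then have "real (a n) \<le> 4 ^ n" using a[of n] by linarith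
    then show ?thesis by simp
  qed
  define g where "g n = f (real (a n) / 4 ^ n)" for n
  have step: "\<bar>g (Suc n) - g n\<bar> \<le> 12 * (real n + 1) / 2 ^ Suc n" if n: "r \<le> n" for n
  proof -
    have "real (4 * a n) < real (a (Suc n) + 1)" "real (a (Suc n)) < real (4 * a n + 4)"
      using a[of n] a[of "Suc n"] by simp_all
    then have "4 * a n < a (Suc n) + 1" "a (Suc n) < 4 * a n + 4" by (simp_all only: of_nat_less_iff)
    then have *: "4 * a n \<le> a (Suc n)" "a (Suc n) - 4 * a n \<le> 3" by linarith+
    define i where "i = a (Suc n) - 4 * a n"
    have ai: "a (Suc n) = 4 * a n + i" "i \<le> 3" using * by (auto simp: i_def)
    have "\<bar>f (real (4 * a n + i) / 4 ^ Suc n) - f (real (4 * a n) / 4 ^ Suc n)\<bar> \<le> real i * (4 * real (Suc n) / 2 ^ Suc n)"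
      using a4[of "Suc n"] n unfolding ai by (intro grid_chain inc) auto
    also have "\<dots> \<le> 3 * (4 * real (Suc n) / 2 ^ Suc n)" using ai by (intro mult_right_mono) auto
    also have "real (4 * a n) / 4 ^ Suc n = real (a n) / 4 ^ n" by simp
    finally show ?thesis unfolding g_def ai by (simp add: add.commute)
  qed
  \<comment> \<open>The right side telescopes: \<open>12 * (real n + 1) / 2 ^ Suc n\<close> is the
    drop of \<open>12 * (real n + 2) / 2 ^ n\<close> from \<open>n\<close> to
    \<open>Suc n\<close>.\<close>
  have bound: "\<bar>g (r + d) - g r\<bar> \<le> 12 * (real r + 2) / 2 ^ r - 12 * (real (r + d) + 2) / 2 ^ (r + d)" for d
  proof (induction d)
    case (Suc d)
    have "\<bar>g (Suc (r + d)) - g (r + d)\<bar> \<le> 12 * (real (r + d) + 1) / 2 ^ Suc (r + d)"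
      by (rule step) simp
    also have "\<dots> = 12 * (real (r + d) + 2) / 2 ^ (r + d) - 12 * (real (Suc (r + d)) + 2) / 2 ^ Suc (r + d)"
      by (simp add: field_simps)
    finally show ?case using Suc unfolding add_Suc_right by linarith
  qed simp
  have "(\<lambda>n. real (a n) / 4 ^ n) \<longlonglongrightarrow> t"
  proof (rule real_tendsto_sandwich)
    show "\<forall>\<^sub>F n in sequentially. t - 1 / 4 ^ n \<le> real (a n) / 4 ^ n"
    proof (intro always_eventually allI)
      fix n
      have "(t * 4 ^ n - 1) / 4 ^ n \<le> real (a n) / 4 ^ n"
        using a(2)[of n] by (intro divide_right_mono) auto
      then show "t - 1 / 4 ^ n \<le> real (a n) / 4 ^ n" by (simp add: diff_divide_distrib)
    qed
    show "\<forall>\<^sub>F n in sequentially. real (a n) / 4 ^ n \<le> t"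
      using a by (intro always_eventually allI) (simp add: field_simps)
    have "(\<lambda>n. 1 / 4 ^ n :: real) \<longlonglongrightarrow> 0" by real_asymp
    from tendsto_diff[OF tendsto_const this, of t]
    show "(\<lambda>n. t - 1 / 4 ^ n) \<longlonglongrightarrow> t" by simp
  qed auto
  then have "g \<longlonglongrightarrow> f t"
    unfolding g_def
  proof (rule continuous_on_tendsto_compose[OF cont _ t])
    have "real (a n) \<le> 4 ^ n" for n using a4[of n] by simp
    then show "\<forall>\<^sub>F n in sequentially. real (a n) / 4 ^ n \<in> {0..1}" by simp
  qed
  then have "(\<lambda>d. \<bar>g (d + r) - g r\<bar>) \<longlonglongrightarrow> \<bar>f t - g r\<bar>"
    by (intro tendsto_rabs tendsto_diff tendsto_const LIMSEQ_ignore_initial_segment)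
  then have "\<bar>f t - g r\<bar> \<le> 12 * (real r + 2) / 2 ^ r"
  proof (rule LIMSEQ_le_const2)
    show "\<exists>N. \<forall>n\<ge>N. \<bar>g (n + r) - g r\<bar> \<le> 12 * (real r + 2) / 2 ^ r"
    proof (intro exI allI impI)
      fix n
      have "0 \<le> 12 * (real (r + n) + 2) / 2 ^ (r + n)" by simp
      with bound[of n] show "\<bar>g (n + r) - g r\<bar> \<le> 12 * (real r + 2) / 2 ^ r"
        unfolding add.commute[of n r] by linarith
    qed
  qed
  then show ?thesis by (simp add: g_def a_def)
qed

text \<open>The cover consists of the grid cells whose left endpoint has a value within the modulus
  of some level in \<open>C\<close>. Each level accounts for at most \<open>level_sum r f\<close>
  cells, whatever its value.\<close>

lemma hausdorff_measure_levels_zero: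
  assumes s: "0 < s"
    and modulus: "\<forall>\<^sub>F r in sequentially. \<forall>t\<in>{0..1}. \<bar>f t - f (real (nat \<lfloor>t * 4 ^ r\<rfloor>) / 4 ^ r)\<bar> \<le> 12 * (real r + 2) / 2 ^ r"
    and count: "(\<lambda>r. level_sum r f * (1 / 4 ^ r) powr s) \<longlonglongrightarrow> 0"
    and C: "finite C" and A: "A \<subseteq> {t\<in>{0..1}. f t \<in> C}"
  shows "hausdorff_measure s A = 0"
proof -
  have "hausdorff_pre s \<delta> A \<le> 0" if \<delta>: "0 < \<delta>" for \<delta>
  proof (rule ennreal_le_epsilon)
    fix \<epsilon> :: real assume \<epsilon>: "0 < \<epsilon>"
    have "(\<lambda>r. real (card C) * (level_sum r f * (1 / 4 ^ r) powr s)) \<longlonglongrightarrow> real (card C) * 0"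
      by (intro tendsto_mult tendsto_const count)
    then have "\<forall>\<^sub>F r in sequentially. real (card C) * (level_sum r f * (1 / 4 ^ r) powr s) < \<epsilon>"
      by (rule order_tendstoD) (use \<epsilon> in simp)
    with modulus eventually_inverse_power_less[OF \<delta>]
    have "\<forall>\<^sub>F r in sequentially. (\<forall>t\<in>{0..1}. \<bar>f t - f (real (nat \<lfloor>t * 4 ^ r\<rfloor>) / 4 ^ r)\<bar> \<le> 12 * (real r + 2) / 2 ^ r)
        \<and> real (card C) * (level_sum r f * (1 / 4 ^ r) powr s) < \<epsilon> \<and> 4 / 4 ^ r < \<delta>"
      by (intro eventually_conj)
    from eventually_happens'[OF sequentially_bot this]
    obtain r where r: "(\<forall>t\<in>{0..1}. \<bar>f t - f (real (nat \<lfloor>t * 4 ^ r\<rfloor>) / 4 ^ r)\<bar> \<le> 12 * (real r + 2) / 2 ^ r)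
        \<and> real (card C) * (level_sum r f * (1 / 4 ^ r) powr s) < \<epsilon> \<and> 4 / 4 ^ r < \<delta>"
      by (rule exE)
    note mod = r[THEN conjunct1] and small = r[THEN conjunct2, THEN conjunct1] and r\<delta> = r[THEN conjunct2, THEN conjunct2]
    \<comment> \<open>The index \<open>4 ^ r\<close> is included to serve
      \<open>t = 1\<close>.\<close>
    define Q where "Q c = {k. k \<le> 4 ^ r \<and> \<bar>f (real k / 4 ^ r) - c\<bar> \<le> 12 * (real r + 2) / 2 ^ r}" for c
    define K where "K = (\<Union>c\<in>C. Q c)"
    \<comment> \<open>Empty sets contribute 0 to the series, which thus becomes a sum over the
      finite set \<open>K\<close>.\<close>
    define U where "U i = (if i \<in> K then {real i / 4 ^ r..(real i + 1) / 4 ^ r} else {})" for i :: nat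
    have "finite (Q c)" for c
      by (rule finite_subset[of _ "{..4 ^ r}"]) (auto simp: Q_def)
    then have fin: "finite K"
      unfolding K_def using C by (intro finite_UN_I)
    have diam: "diameter (U i) = (if i \<in> K then 1 / 4 ^ r else 0)" for i
    proof -
      have "real i / 4 ^ r \<le> (real i + 1) / 4 ^ r" by (intro divide_right_mono) auto
      then show ?thesis by (simp add: U_def diff_divide_distrib[symmetric])
    qed
    have cover: "A \<subseteq> (\<Union>i. U i)"
    proof
      fix t assume "t \<in> A"
      then have t: "t \<in> {0..1}" "f t \<in> C" using A by auto
      define k where "k = nat \<lfloor>t * 4 ^ r\<rfloor>"
      have "real k = real_of_int \<lfloor>t * 4 ^ r\<rfloor>" using t by (simp add: k_def)
      then have k: "real k \<le> t * 4 ^ r" "t * 4 ^ r \<le> real k + 1" by linarith+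
      have "t * 4 ^ r \<le> 1 * 4 ^ r" using t by (intro mult_right_mono) auto
      then have "real k \<le> 4 ^ r" using k by linarith
      then have "k \<le> 4 ^ r" by simp
      moreover have "\<bar>f (real k / 4 ^ r) - f t\<bar> \<le> 12 * (real r + 2) / 2 ^ r"
        using bspec[OF mod t(1)] by (simp add: k_def abs_minus_commute)
      ultimately have "k \<in> K" using t by (auto simp: K_def Q_def)
      then have "t \<in> U k" using k by (simp add: U_def field_simps)
      then show "t \<in> (\<Union>i. U i)" by blast
    qed
    have "hausdorff_pre s \<delta> A \<le> (\<Sum>i. ennreal (hcontrib s (U i)))"
      unfolding hausdorff_pre_def
    proof (rule INF_lower, intro CollectI conjI allI cover)
      show "bounded (U i)" for i by (simp add: U_def)
      have "1 / 4 ^ r \<le> 4 / (4::real) ^ r" by (simp add: divide_right_mono)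
      then show "diameter (U i) \<le> \<delta>" for i using r\<delta> \<delta> by (simp add: diam)
    qed
    also have "\<dots> = (\<Sum>i\<in>K. ennreal (hcontrib s (U i)))"
      by (rule suminf_finite[OF fin]) (simp add: U_def hcontrib_def)
    also have "\<dots> = (\<Sum>i\<in>K. ennreal ((1 / 4 ^ r) powr s))"
    proof (intro sum.cong refl arg_cong[of _ _ ennreal])
      fix i assume "i \<in> K"
      moreover have "real i / 4 ^ r \<in> U i"
        using \<open>i \<in> K\<close> by (auto simp: U_def intro: divide_right_mono)
      ultimately show "hcontrib s (U i) = (1 / 4 ^ r) powr s" using s by (auto simp: hcontrib_def diam)
    qed
    also have "\<dots> = ennreal (real (card K) * (1 / 4 ^ r) powr s)"
      by (subst sum_ennreal) auto
    also have "\<dots> \<le> ennreal \<epsilon>"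
    proof (rule ennreal_leI)
      have "real (card K) \<le> (\<Sum>c\<in>C. real (card (Q c)))"
        unfolding K_def using card_UN_le[OF C, of Q] by (simp flip: of_nat_sum)
      also have "\<dots> \<le> (\<Sum>c\<in>C. level_sum r f)"
        unfolding Q_def by (intro sum_mono card_level_le)
      finally have "real (card K) * (1 / 4 ^ r) powr s \<le> (real (card C) * level_sum r f) * (1 / 4 ^ r) powr s"
        by (intro mult_right_mono) auto
      then show "real (card K) * (1 / 4 ^ r) powr s \<le> \<epsilon>" using small unfolding mult.assoc by linarith
    qed
    finally show "hausdorff_pre s \<delta> A \<le> 0 + ennreal \<epsilon>" by simp
  qed
  then have "(SUP \<delta>\<in>{0<..}. hausdorff_pre s \<delta> A) \<le> 0" by (intro SUP_least) auto
  then show ?thesis unfolding hausdorff_measure_def by (simp only: le_zero_eq)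
qed

text \<open>Countably many exponents decreasing to \<open>d\<close> suffice, which is what the
  almost sure statement can supply.\<close>

lemma hausdorff_dim_le:
  assumes "0 \<le> d" and "\<And>n::nat. hausdorff_measure (d + 1 / real (Suc n)) A = 0"
  shows "hausdorff_dim A \<le> d"
proof (rule LIMSEQ_le_const)
  have "(\<lambda>n. 1 / real (Suc n)) \<longlonglongrightarrow> 0" by real_asymp
  from tendsto_add[OF tendsto_const this, of d]
  show "(\<lambda>n. d + 1 / real (Suc n)) \<longlonglongrightarrow> d" by simp
  show "\<exists>N. \<forall>n\<ge>N. hausdorff_dim A \<le> d + 1 / real (Suc n)"
    unfolding hausdorff_dim_def using assms
    by (intro exI[of _ 0] allI impI cInf_lower bdd_belowI[of _ 0]) auto
qed

section \<open>One-sided derivatives of the composition and zeros of the derivative of F\<close>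

lemma derivative_imp_lipschitz_eventually:
  fixes g :: "real \<Rightarrow> real"
  assumes "(g has_real_derivative D) (at x within S)"
  shows "\<forall>\<^sub>F t in at x within S. \<bar>g t - g x\<bar> \<le> (\<bar>D\<bar> + 1) * \<bar>t - x\<bar>"
proof -
  have "((\<lambda>t. \<bar>(g t - g x) / (t - x)\<bar>) \<longlongrightarrow> \<bar>D\<bar>) (at x within S)"
    using assms unfolding has_field_derivative_iff by (rule tendsto_rabs)
  then have "\<forall>\<^sub>F t in at x within S. \<bar>(g t - g x) / (t - x)\<bar> < \<bar>D\<bar> + 1"
    by (rule order_tendstoD) simp
  moreover have "\<forall>\<^sub>F t in at x within S. t \<noteq> x" by (simp add: eventually_at_filter)
  ultimately show ?thesis
    by eventually_elim (simp add: abs_divide field_simps)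
qed

text \<open>The difference quotient has modulus near \<open>cmod D\<close>. The full neighbourhood
  filter is used because the path may return to \<open>b\<close> at times arbitrarily close to the
  given one, and at \<open>b\<close> itself the inequality is trivial.\<close>

lemma nonzero_derivative_imp_expanding:
  fixes F :: "complex \<Rightarrow> complex"
  assumes "(F has_field_derivative D) (at b)" and D: "D \<noteq> 0"
  shows "\<forall>\<^sub>F z in nhds b. cmod D / 2 * cmod (z - b) \<le> cmod (F z - F b)"
proof -
  have "((\<lambda>z. cmod ((F z - F b) / (z - b))) \<longlongrightarrow> cmod D) (at b)"
    using assms unfolding has_field_derivative_iff by (intro tendsto_norm)
  then have "\<forall>\<^sub>F z in at b. cmod D / 2 < cmod ((F z - F b) / (z - b))"
    by (rule order_tendstoD) (use D in simp)
  then have "\<forall>\<^sub>F z in at b. cmod D / 2 * cmod (z - b) \<le> cmod (F z - F b)"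
    unfolding eventually_at_filter
    by eventually_elim (auto simp: norm_divide field_simps)
  then show ?thesis by (simp add: eventually_nhds_conv_at)
qed

text \<open>The derivative bounds the increments of the composition from above, and expansion of
  \<open>F\<close> bounds them from below by those of \<open>f\<close>. Real values along the path
  let the modulus of an increment of \<open>F\<close> be read off from real parts.\<close>

lemma derivative_of_composition_imp_lipschitz:
  fixes F :: "complex \<Rightarrow> complex" and f :: "real \<Rightarrow> real"
  assumes cont: "continuous_on {0..1} f" and x: "x \<in> {0..1}" and S: "S \<subseteq> {0..1}"
    and F: "(F has_field_derivative D) (at (complex_of_real (f x)))" "D \<noteq> 0"
    and real: "\<And>t. t \<in> {0..1} \<Longrightarrow> F (complex_of_real (f t)) \<in> \<real>"
    and der: "((\<lambda>t. Re (F (complex_of_real (f t)))) has_real_derivative D') (at x within S)"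
  obtains L \<delta> where "0 \<le> L" "0 < \<delta>" "\<And>t. t \<in> S \<Longrightarrow> t \<noteq> x \<Longrightarrow> \<bar>t - x\<bar> < \<delta> \<Longrightarrow> \<bar>f t - f x\<bar> \<le> L * \<bar>t - x\<bar>"
proof -
  have "continuous (at x within {0..1}) f" using cont x by (simp add: continuous_on_eq_continuous_within)
  then have "(f \<longlongrightarrow> f x) (at x within S)"
    unfolding continuous_within by (rule tendsto_within_subset[OF _ S])
  then have "((\<lambda>t. complex_of_real (f t)) \<longlongrightarrow> complex_of_real (f x)) (at x within S)"
    by (rule tendsto_of_real)
  then have "\<forall>\<^sub>F t in at x within S. cmod D / 2 * cmod (complex_of_real (f t) - complex_of_real (f x)) \<le>
      cmod (F (complex_of_real (f t)) - F (complex_of_real (f x)))"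
    using nonzero_derivative_imp_expanding[OF F] by (rule eventually_compose_filterlim[rotated])
  moreover have "\<forall>\<^sub>F t in at x within S. t \<in> S" by (simp add: eventually_at_filter)
  moreover note derivative_imp_lipschitz_eventually[OF der]
  ultimately have "\<forall>\<^sub>F t in at x within S. \<bar>f t - f x\<bar> \<le> 2 * (\<bar>D'\<bar> + 1) / cmod D * \<bar>t - x\<bar>"
  proof eventually_elim
    case (elim t)
    have "t \<in> {0..1}" using elim S by auto
    then have "cmod (F (complex_of_real (f t)) - F (complex_of_real (f x))) =
        \<bar>Re (F (complex_of_real (f t))) - Re (F (complex_of_real (f x)))\<bar>"
      using real[of t] real[OF x] by (metis Reals_diff Re_complex_of_real in_Reals_norm minus_complex.sel(1))
    moreover have "cmod (complex_of_real (f t) - complex_of_real (f x)) = \<bar>f t - f x\<bar>"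
      by (metis norm_of_real of_real_diff)
    ultimately have "cmod D / 2 * \<bar>f t - f x\<bar> \<le> (\<bar>D'\<bar> + 1) * \<bar>t - x\<bar>"
      using elim by simp
    then show ?case using F(2) by (simp add: field_simps)
  qed
  then obtain \<delta> where "0 < \<delta>" "\<And>t. t \<in> S \<Longrightarrow> t \<noteq> x \<Longrightarrow> dist t x < \<delta> \<Longrightarrow> \<bar>f t - f x\<bar> \<le> 2 * (\<bar>D'\<bar> + 1) / cmod D * \<bar>t - x\<bar>"
    unfolding eventually_at by blast
  then show ?thesis by (intro that[of "2 * (\<bar>D'\<bar> + 1) / cmod D" \<delta>]) (auto simp: dist_real_def)
qed

lemma one_sided_derivative_imp_critical:
  fixes F :: "complex \<Rightarrow> complex" and f :: "real \<Rightarrow> real"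
  assumes lim: "\<And>K::nat. 1 \<le> K \<Longrightarrow> (\<lambda>r. triple_sum r (1 / real K) f) \<longlonglongrightarrow> 0"
    and cont: "continuous_on {0..1} f" and x: "x \<in> {0..1}"
    and F: "(F has_field_derivative D) (at (complex_of_real (f x)))"
    and real: "\<And>t. t \<in> {0..1} \<Longrightarrow> F (complex_of_real (f t)) \<in> \<real>"
    and der: "has_finite_one_sided_deriv (\<lambda>t. Re (F (complex_of_real (f t)))) x"
  shows "D = 0"
proof (rule ccontr)
  assume D: "D \<noteq> 0"
  from der consider
      D' where "x < 1" "((\<lambda>t. Re (F (complex_of_real (f t)))) has_real_derivative D') (at x within {x<..1})"
    | D' where "0 < x" "((\<lambda>t. Re (F (complex_of_real (f t)))) has_real_derivative D') (at x within {0..<x})"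
    unfolding has_finite_one_sided_deriv_def by blast
  then show False
  proof cases
    case 1
    have "{x<..1} \<subseteq> {0..1}" using x by auto
    then obtain L \<delta> where L: "0 \<le> L" "0 < \<delta>" "\<And>t. t \<in> {x<..1} \<Longrightarrow> t \<noteq> x \<Longrightarrow> \<bar>t - x\<bar> < \<delta> \<Longrightarrow> \<bar>f t - f x\<bar> \<le> L * \<bar>t - x\<bar>"
      using derivative_of_composition_imp_lipschitz[OF cont x _ F D real 1(2)] by blast
    show False
      by (rule not_lipschitz_right[OF lim _ 1(1) L(2) L(3) L(1)]) (use x in auto)
  next
    case 2
    have "{0..<x} \<subseteq> {0..1}" using x by auto
    then obtain L \<delta> where L: "0 \<le> L" "0 < \<delta>" "\<And>t. t \<in> {0..<x} \<Longrightarrow> t \<noteq> x \<Longrightarrow> \<bar>t - x\<bar> < \<delta> \<Longrightarrow> \<bar>f t - f x\<bar> \<le> L * \<bar>t - x\<bar>"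
      using derivative_of_composition_imp_lipschitz[OF cont x _ F D real 2(2)] by blast
    show False
      by (rule not_lipschitz_left[OF lim 2(1) _ L(2) L(3) L(1)]) (use x in auto)
  qed
qed

text \<open>Zeros of a nonconstant holomorphic function on a connected open set are finite in number
  on a compact subset; here the function is \<open>deriv F\<close> and the compact set is the range
  of the path.\<close>

lemma finite_critical_values:
  fixes F :: "complex \<Rightarrow> complex" and f :: "real \<Rightarrow> real"
  assumes cont: "continuous_on {0..1} f" and U: "open U" "connected U" "complex_of_real ` (f ` {0..1}) \<subseteq> U"
    and F: "F holomorphic_on U" and nonconst: "\<not> (\<exists>c. \<forall>z\<in>U. F z = c)"
  shows "finite {y \<in> f ` {0..1}. deriv F (complex_of_real y) = 0}"
proof -
  let ?K = "complex_of_real ` (f ` {0..1})"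
  have K: "compact ?K"
    by (intro compact_continuous_image continuous_intros cont compact_Icc)
  have fin: "finite {z \<in> ?K. deriv F z = 0}"
  \<comment> \<open>If \<open>deriv F\<close> is constant, its value is nonzero because
    \<open>F\<close> is nonconstant on the connected set \<open>U\<close>, so there are no critical
    values at all.\<close>
  proof (cases "deriv F constant_on U")
    case True
    then obtain c where c: "\<And>z. z \<in> U \<Longrightarrow> deriv F z = c" by (auto simp: constant_on_def)
    have "c \<noteq> 0"
    proof
      assume "c = 0"
      then have "(F has_field_derivative 0) (at z)" if "z \<in> U" for z
        using holomorphic_derivI[OF F U(1) that] c[OF that] by simp
      then have "F constant_on U"
        using U(2,1) by (rule has_field_derivative_0_imp_constant_on)
      then have "\<exists>c. \<forall>z\<in>U. F z = c"
        unfolding constant_on_def .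
      with nonconst show False by simp
    qed
    then have "{z \<in> ?K. deriv F z = 0} = {}" using c U(3) by auto
    then show ?thesis by (simp only: finite.emptyI)
  next
    case False
    then show ?thesis
      using holomorphic_compact_finite_zeros[OF holomorphic_deriv[OF F U(1)] U(1,2) K U(3)] by blast
  qed
  have "complex_of_real ` {y \<in> f ` {0..1}. deriv F (complex_of_real y) = 0} \<subseteq> {z \<in> ?K. deriv F z = 0}"
    by auto
  then have "finite (complex_of_real ` {y \<in> f ` {0..1}. deriv F (complex_of_real y) = 0})"
    using fin by (rule finite_subset)
  then show ?thesis by (rule finite_imageD) (simp add: inj_on_def)
qed

theorem mainTheorem13:
  fixes M :: "'a measure" and B :: "'a \<Rightarrow> real \<Rightarrow> real"
  assumes "brownian_bridge M B"
  shows "AE \<omega> in M.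
    \<forall>(F :: complex \<Rightarrow> complex) (U :: complex set).
      open U \<and> connected U \<and> complex_of_real ` (B \<omega> ` {0..1}) \<subseteq> U \<and>
      F holomorphic_on U \<and> \<not> (\<exists>c. \<forall>z\<in>U. F z = c) \<and>
      (\<forall>x\<in>{0..1}. F (complex_of_real (B \<omega> x)) \<in> \<real>)
      \<longrightarrow>
      (let S = {x \<in> {0..1}. has_finite_one_sided_deriv
                   (\<lambda>t. Re (F (complex_of_real (B \<omega> t)))) x}
       in S = {} \<or> (\<exists>p. S = {p}) \<or> hausdorff_dim S \<le> 1/2)"
proof -
  interpret prob_space M using assms by (simp add: brownian_bridge_def)
  interpret bridge M B by unfold_locales (rule assms)
  have cont: "AE \<omega> in M. continuous_on {0..1} (B \<omega>)"
    using assms by (simp add: brownian_bridge_def)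
  \<comment> \<open>\<open>F\<close> and \<open>U\<close> range over uncountable families, so every
    almost sure fact is fixed before they are chosen. The exponents
    \<open>1 / 2 + 1 / real (Suc n)\<close> here and the integers \<open>K\<close> below leave only
    countably many null sets to discard.\<close>
  have levels: "AE \<omega> in M. \<forall>n. (\<lambda>r. level_sum r (B \<omega>) * (1 / 4 ^ r) powr (1 / 2 + 1 / real (Suc n))) \<longlonglongrightarrow> 0"
    by (subst AE_all_countable) (auto intro!: AE_level_sum)
  have triples: "AE \<omega> in M. \<forall>K::nat. 1 \<le> K \<longrightarrow> (\<lambda>r. triple_sum r (1 / real K) (B \<omega>)) \<longlonglongrightarrow> 0"
    by (subst AE_all_countable) (auto intro!: AE_impI AE_triple_sum)
  from cont levels triples grid_increment_modulus show ?thesis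
  proof eventually_elim
    case (elim \<omega>)
    show ?case
    proof (intro allI impI, elim conjE)
      fix F :: "complex \<Rightarrow> complex" and U :: "complex set"
      assume U: "open U" "connected U" "complex_of_real ` (B \<omega> ` {0..1}) \<subseteq> U"
        and F: "F holomorphic_on U" "\<not> (\<exists>c. \<forall>z\<in>U. F z = c)"
        and real: "\<forall>x\<in>{0..1}. F (complex_of_real (B \<omega> x)) \<in> \<real>"
      define S where "S = {x \<in> {0..1}. has_finite_one_sided_deriv (\<lambda>t. Re (F (complex_of_real (B \<omega> t)))) x}"
      define C where "C = {y \<in> B \<omega> ` {0..1}. deriv F (complex_of_real y) = 0}"
      have C: "finite C"
        unfolding C_def by (rule finite_critical_values[OF elim(1) U F])
      have S: "S \<subseteq> {t\<in>{0..1}. B \<omega> t \<in> C}"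
      proof
        fix x assume x: "x \<in> S"
        then have x01: "x \<in> {0..1}" by (simp add: S_def)
        have F': "(F has_field_derivative deriv F (complex_of_real (B \<omega> x))) (at (complex_of_real (B \<omega> x)))"
          using U(3) x01 by (intro holomorphic_derivI[OF F(1) U(1)]) blast
        have "has_finite_one_sided_deriv (\<lambda>t. Re (F (complex_of_real (B \<omega> t)))) x"
          using x by (simp add: S_def)
        with elim(3)[rule_format] elim(1) x01 F' real[rule_format]
        have "deriv F (complex_of_real (B \<omega> x)) = 0"
          by (rule one_sided_derivative_imp_critical)
        then show "x \<in> {t\<in>{0..1}. B \<omega> t \<in> C}" using x01 by (auto simp: C_def)
      qed
      obtain r0 where r0: "\<And>m k. r0 \<le> m \<Longrightarrow> k < 4 ^ m \<Longrightarrow>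
          \<bar>B \<omega> ((real k + 1) / 4 ^ m) - B \<omega> (real k / 4 ^ m)\<bar> \<le> 4 * real m / 2 ^ m"
        using elim(4) unfolding eventually_sequentially by blast
      have modulus: "\<forall>\<^sub>F r in sequentially. \<forall>t\<in>{0..1}.
          \<bar>B \<omega> t - B \<omega> (real (nat \<lfloor>t * 4 ^ r\<rfloor>) / 4 ^ r)\<bar> \<le> 12 * (real r + 2) / 2 ^ r"
        unfolding eventually_sequentially
      proof (intro exI allI impI ballI)
        fix r t assume "r0 \<le> r" "t \<in> {0..1::real}"
        then show "\<bar>B \<omega> t - B \<omega> (real (nat \<lfloor>t * 4 ^ r\<rfloor>) / 4 ^ r)\<bar> \<le> 12 * (real r + 2) / 2 ^ r"
          by (intro grid_modulus_imp_modulus[OF elim(1)] r0) auto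
      qed
      have "hausdorff_dim S \<le> 1 / 2"
      proof (rule hausdorff_dim_le)
        fix n :: nat
        have "(0::real) < 1 / 2 + 1 / real (Suc n)" by (simp add: add_pos_pos)
        then show "hausdorff_measure (1 / 2 + 1 / real (Suc n)) S = 0"
          using modulus elim(2)[rule_format, of n] C S by (rule hausdorff_measure_levels_zero)
      qed simp
      then show "let S = {x \<in> {0..1}. has_finite_one_sided_deriv (\<lambda>t. Re (F (complex_of_real (B \<omega> t)))) x}
          in S = {} \<or> (\<exists>p. S = {p}) \<or> hausdorff_dim S \<le> 1/2"
        unfolding Let_def S_def by blast
    qed
  qed
qed

end
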